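(* Let $\mathcal{Q}$ be a parallelogram polyomino, let $\mathcal{Q}'$ be a sub-polyomino of $\mathcal{Q}$ which is also a parallelogram polyomino, and let $\mathcal{P}=\mathcal{Q}\setminus\mathcal{Q}'$ (assumed non-empty). Let $K$ be a field, $S=K[x_a\mid a\in V(\mathcal{P})]$, and let $V_1,\dots,V_s$ and $\mathcal{C}_1,\dots,\mathcal{C}_s$ be the vertex sets and cell sets associated with $\mathcal{P}$ (defined in the context). Put $a=\min\{i: V_i\cap V(\mathcal{Q}')\ne\varnothing\}$, $b=\max\{i: V_i\cap V(\mathcal{Q}')\neq\varnothing\}$, $\mathcal{Q}_1=\bigcup_{i<b}\mathcal{C}_i$ and $\mathcal{Q}_2=\bigcup_{i>a}\mathcal{C}_i$. If $I_{\mathcal{Q}_1}+I_{\mathcal{Q}_2}=I_{\mathcal{P}}$ (as ideals of $S$), then $I_{\mathcal{P}}$ is a Knutson ideal.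
   Context: $\mathbb{N}$ is the set of nonnegative integers, and $(i,j)\le (k,l)$ in $\mathbb{N}^2$ means $i\le k$ and $j\le l$. For $a=(i,j)\le b=(k,l)$ put $[a,b]=\{m\in\mathbb{N}^2: a\le m\le b\}$; it is a proper interval if $i<k$ and $j<l$. The diagonal vertices of a proper interval are $a$ (lower-left) and $b$ (upper-right), and its anti-diagonal vertices are $(i,l)$ (upper-left) and $(k,j)$ (lower-right). A cell is $C=[a,a+(1,1)]$; $V(C)$ is the set of its four vertices and its edges are the four pairs of adjacent vertices. For a finite collection of cells $\mathcal{P}$, $V(\mathcal{P})=\bigcup_{C\in\mathcal{P}}V(C)$. A polyomino is a non-empty finite collection of cells in $(\mathbb{N}\setminus\{0\})^2$ such that any two of its cells $C,D$ are joined by a sequence of cells $C=C_1,\dots,C_m=D$ of the collection with $C_i\cap C_{i+1}$ an edge of both for all $i$. A sub-polyomino of $\mathcal{Q}$ is a polyomino all of whose cells are in $\mathcal{Q}$. $\mathcal{Q}\setminus\mathcal{Q}'$ is the collection of cells of $\mathcal{Q}$ not in $\mathcal{Q}'$ (it need not be a polyomino). A polyomino is horizontally convex if whenever two of its cells have lower-left vertices $(i,j)$ and $(k,j)$ with $k>i$, every cell with lower-left vertex $(l,j)$, $i\le l\le k$, belongs to it; vertically convex is defined analogously; convex means both. A parallelogram polyomino is a convex polyomino whose vertex set is a sub-lattice of $\mathbb{N}^2$. For a collection of cells $\mathcal{P}'$, an inner interval is a proper interval $[a,b]$ with $a,b\in V(\mathcal{P}')$ all of whose cells belong to $\mathcal{P}'$,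 and $I_{\mathcal{P}'}$ is the ideal generated by all binomials $x_ax_b-x_cx_d$, where $[a,b]$ ranges over the inner intervals of $\mathcal{P}'$ and $c,d$ are its anti-diagonal vertices. For sub-collections of $\mathcal{P}$ these ideals are taken in $S$. The sets $V_k$ and $\mathcal{C}_k$ for $\mathcal{P}$: partition $V(\mathcal{P})$ into sets $V_1,\dots,V_s$, $V_k=\{v_{k,1},\dots,v_{k,n_k}\}$, such that: (i) for $1\le i<n_k$, $v_{k,i}$ and $v_{k,i+1}$ are respectively the upper-left and lower-right vertices of a cell of $\mathcal{P}$; (ii) $v_{k,1}$ is not a lower-right vertex, and $v_{k,n_k}$ is not an upper-left vertex, of any cell of $\mathcal{P}$; (iii) for $k<l$, with $v_{k,1}=(v_1,v_2)$ and $v_{l,1}=(w_1,w_2)$, either $v_1+v_2<w_1+w_2$, or $v_1+v_2=w_1+w_2$ and $v_1<w_1$. If $V_k$ is a singleton, $\mathcal{C}_k=\varnothing$; otherwise $\mathcal{C}_k=\{C_{k,1},\dots,C_{k,n_k-1}\}$, where $C_{k,i}$ is the cell of $\mathcal{P}$ with anti-diagonal vertices $v_{k,i}$ and $v_{k,i+1}$, $1\le i\le n_k-1$. Knutson ideals: let $f\in S$ be such that $\operatorname{in}_<(f)$ is a square-free monomial for some monomial order $<$ on $S$. $\mathcal{C}_f$ is the smallest set of ideals of $S$ such that: (1) $(f)\in\mathcal{C}_f$; (2) if $I\in\mathcal{C}_f$ and $J$ is any ideal of $S$, then $I:J\in\mathcal{C}_f$; (3) if $I,J\in\mathcal{C}_f$,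 then $I+J\in\mathcal{C}_f$ and $I\cap J\in\mathcal{C}_f$. An ideal is a Knutson ideal if it lies in $\mathcal{C}_f$ for some such $f$. *)

theory Defs
  imports
    "HOL-Library.Poly_Mapping"
    "HOL-Library.Product_Plus"
    "HOL-Library.Product_Order"
    "HOL-Algebra.Ideal"
begin

section \<open>Collections of cells\<close>

text \<open>
  A cell is encoded by its lower-left vertex. With \<^theory>\<open>HOL-Library.Product_Order\<close> the order
  on pairs is the componentwise one, so \<open>{a..b}\<close> is the interval $[a,b]$ of $\mathbb{N}^2$, and
  \<open>inf\<close>, \<open>sup\<close> are the lattice operations of $\mathbb{N}^2$.
\<close>

type_synonym point = "nat \<times> nat"
type_synonym cell = "nat \<times> nat"

definition lower_left :: "cell \<Rightarrow> point" where "lower_left C = C"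
definition lower_right :: "cell \<Rightarrow> point" where "lower_right C = C + (1, 0)"
definition upper_left :: "cell \<Rightarrow> point" where "upper_left C = C + (0, 1)"
definition upper_right :: "cell \<Rightarrow> point" where "upper_right C = C + (1, 1)"

definition cell_vertices :: "cell \<Rightarrow> point set" where
  "cell_vertices C = {lower_left C, lower_right C, upper_left C, upper_right C}"

definition cell_edges :: "cell \<Rightarrow> point set set" where
  "cell_edges C =
     {{lower_left C, lower_right C}, {upper_left C, upper_right C},
      {lower_left C, upper_left C}, {lower_right C, upper_right C}}"

definition vertices :: "cell set \<Rightarrow> point set" where
  "vertices P = (\<Union>C\<in>P. cell_vertices C)"

definition adjacent_cells :: "cell \<Rightarrow> cell \<Rightarrow> bool" where
  "adjacent_cells C D \<longleftrightarrow>
     cell_vertices C \<inter> cell_vertices D \<in> cell_edges C \<inter> cell_edges D"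

definition polyomino :: "cell set \<Rightarrow> bool" where
  "polyomino P \<longleftrightarrow> finite P \<and> P \<noteq> {} \<and> (\<forall>C\<in>P. (1, 1) \<le> C) \<and>
     (\<forall>C\<in>P. \<forall>D\<in>P. \<exists>Cs. Cs \<noteq> [] \<and> hd Cs = C \<and> last Cs = D \<and> set Cs \<subseteq> P \<and>
        (\<forall>i. Suc i < length Cs \<longrightarrow> adjacent_cells (Cs ! i) (Cs ! Suc i)))"

definition sub_polyomino :: "cell set \<Rightarrow> cell set \<Rightarrow> bool" where
  "sub_polyomino Q' Q \<longleftrightarrow> polyomino Q' \<and> Q' \<subseteq> Q"

definition horizontally_convex :: "cell set \<Rightarrow> bool" where
  "horizontally_convex P \<longleftrightarrow>
     (\<forall>i k j. (i, j) \<in> P \<and> (k, j) \<in> P \<and> i < k \<longrightarrow> (\<forall>l. i \<le> l \<and> l \<le> k \<longrightarrow> (l, j) \<in> P))"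

definition vertically_convex :: "cell set \<Rightarrow> bool" where
  "vertically_convex P \<longleftrightarrow>
     (\<forall>i j k. (i, j) \<in> P \<and> (i, k) \<in> P \<and> j < k \<longrightarrow> (\<forall>l. j \<le> l \<and> l \<le> k \<longrightarrow> (i, l) \<in> P))"

definition sublattice :: "point set \<Rightarrow> bool" where
  "sublattice L \<longleftrightarrow> (\<forall>u\<in>L. \<forall>v\<in>L. inf u v \<in> L \<and> sup u v \<in> L)"

definition parallelogram_polyomino :: "cell set \<Rightarrow> bool" where
  "parallelogram_polyomino P \<longleftrightarrow>
     polyomino P \<and> horizontally_convex P \<and> vertically_convex P \<and> sublattice (vertices P)"

definition proper_interval :: "point \<Rightarrow> point \<Rightarrow> bool" where
  "proper_interval u v \<longleftrightarrow> fst u < fst v \<and> snd u < snd v"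

definition interval_cells :: "point \<Rightarrow> point \<Rightarrow> cell set" where
  "interval_cells u v = {C. cell_vertices C \<subseteq> {u..v}}"

definition inner_interval :: "cell set \<Rightarrow> point \<Rightarrow> point \<Rightarrow> bool" where
  "inner_interval P u v \<longleftrightarrow>
     proper_interval u v \<and> u \<in> vertices P \<and> v \<in> vertices P \<and> interval_cells u v \<subseteq> P"

section \<open>The sets \<open>V\<^sub>k\<close> and \<open>\<C>\<^sub>k\<close>\<close>

text \<open>
  The partition is given by a list \<open>Vs\<close>, whose entry \<open>Vs ! k\<close> enumerates one class; all indices
  start at \<open>0\<close> instead of \<open>1\<close>. The conditions determine \<open>Vs\<close> uniquely: each class is a maximal
  chain of vertices, and the classes are listed in the order of their first vertices.
\<close>

definition antidiagonal_partition :: "cell set \<Rightarrow> point list list \<Rightarrow> bool" where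
  "antidiagonal_partition P Vs \<longleftrightarrow>
     (\<forall>vs\<in>set Vs. vs \<noteq> []) \<and>
     (\<Union>vs\<in>set Vs. set vs) = vertices P \<and>
     (\<forall>k l. k < l \<and> l < length Vs \<longrightarrow> set (Vs ! k) \<inter> set (Vs ! l) = {}) \<and>
     (\<forall>vs\<in>set Vs. \<forall>i. Suc i < length vs \<longrightarrow>
        (\<exists>C\<in>P. vs ! i = upper_left C \<and> vs ! Suc i = lower_right C)) \<and>
     (\<forall>vs\<in>set Vs. \<forall>C\<in>P. hd vs \<noteq> lower_right C \<and> last vs \<noteq> upper_left C) \<and>
     (\<forall>k l. k < l \<and> l < length Vs \<longrightarrow>
        (let (v1, v2) = hd (Vs ! k); (w1, w2) = hd (Vs ! l)
         in v1 + v2 < w1 + w2 \<or> v1 + v2 = w1 + w2 \<and> v1 < w1))"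

text \<open>This is empty when \<open>vs\<close> is a singleton.\<close>

definition chain_cells :: "cell set \<Rightarrow> point list \<Rightarrow> cell set" where
  "chain_cells P vs =
     {C \<in> P. \<exists>i. Suc i < length vs \<and> upper_left C = vs ! i \<and> lower_right C = vs ! Suc i}"

section \<open>Polynomial rings and polyomino ideals\<close>

text \<open>
  \<open>('v, 'k) mpoly\<close> is the polynomial ring over \<open>'k\<close> with one indeterminate for each element of
  \<open>'v\<close>; the product of \<^theory>\<open>HOL-Library.Poly_Mapping\<close> is convolution. Monomials are exponent
  vectors of finite support. \<open>poly_ring X\<close> is the ring of those polynomials that involve only
  indeterminates from \<open>X\<close>.
\<close>

type_synonym 'v monom = "'v \<Rightarrow>\<^sub>0 nat"
type_synonym ('v, 'k) mpoly = "'v monom \<Rightarrow>\<^sub>0 'k"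

definition monoms :: "'v set \<Rightarrow> 'v monom set" where
  "monoms X = {m. Poly_Mapping.keys m \<subseteq> X}"

definition poly_ring :: "'v set \<Rightarrow> ('v, 'k::field) mpoly ring" where
  "poly_ring X =
     \<lparr>carrier = {p. Poly_Mapping.keys p \<subseteq> monoms X}, mult = (*), one = 1, zero = 0, add = (+)\<rparr>"

definition indet :: "'v \<Rightarrow> ('v, 'k::field) mpoly" where
  "indet v = Poly_Mapping.single (Poly_Mapping.single v 1) 1"

definition inner_binomials :: "cell set \<Rightarrow> (point, 'k::field) mpoly set" where
  "inner_binomials P =
     {indet u * indet v - indet (fst u, snd v) * indet (fst v, snd u) | u v. inner_interval P u v}"

definition polyomino_ideal ::
    "(point, 'k::field) mpoly ring \<Rightarrow> cell set \<Rightarrow> (point, 'k) mpoly set" where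
  "polyomino_ideal S P = Idl\<^bsub>S\<^esub> (inner_binomials P)"

section \<open>Knutson ideals\<close>

definition colon_ideal :: "('r, 'm) ring_scheme \<Rightarrow> 'r set \<Rightarrow> 'r set \<Rightarrow> 'r set" where
  "colon_ideal R I J = {x \<in> carrier R. \<forall>y\<in>J. x \<otimes>\<^bsub>R\<^esub> y \<in> I}"

inductive_set knutson_class :: "('r, 'm) ring_scheme \<Rightarrow> 'r \<Rightarrow> 'r set set" for R f where
  principal: "Idl\<^bsub>R\<^esub> {f} \<in> knutson_class R f"
| colon: "I \<in> knutson_class R f \<Longrightarrow> ideal J R \<Longrightarrow> colon_ideal R I J \<in> knutson_class R f"
| sum: "I \<in> knutson_class R f \<Longrightarrow> J \<in> knutson_class R f \<Longrightarrow> I <+>\<^bsub>R\<^esub> J \<in> knutson_class R f"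
| inter: "I \<in> knutson_class R f \<Longrightarrow> J \<in> knutson_class R f \<Longrightarrow> I \<inter> J \<in> knutson_class R f"

text \<open>\<open>(m, n) \<in> r\<close> means that \<open>m\<close> is less than or equal to \<open>n\<close>.\<close>

definition monomial_order :: "'v set \<Rightarrow> 'v monom rel \<Rightarrow> bool" where
  "monomial_order X r \<longleftrightarrow>
     linear_order_on (monoms X) r \<and>
     (\<forall>m\<in>monoms X. (0, m) \<in> r) \<and>
     (\<forall>m n t. (m, n) \<in> r \<and> t \<in> monoms X \<longrightarrow> (m + t, n + t) \<in> r)"

text \<open>Meaningful for \<open>p \<noteq> 0\<close> only; the coefficient is disregarded.\<close>

definition initial_monom :: "'v monom rel \<Rightarrow> ('v, 'k::field) mpoly \<Rightarrow> 'v monom" where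
  "initial_monom r p =
     (THE m. m \<in> Poly_Mapping.keys p \<and> (\<forall>n\<in>Poly_Mapping.keys p. (n, m) \<in> r))"

definition squarefree_monom :: "'v monom \<Rightarrow> bool" where
  "squarefree_monom m \<longleftrightarrow> (\<forall>v. Poly_Mapping.lookup m v \<le> 1)"

definition knutson_ideal :: "'v set \<Rightarrow> ('v, 'k::field) mpoly set \<Rightarrow> bool" where
  "knutson_ideal X I \<longleftrightarrow>
     (\<exists>r f. monomial_order X r \<and> f \<in> carrier (poly_ring X) \<and> f \<noteq> 0 \<and>
        squarefree_monom (initial_monom r f) \<and> I \<in> knutson_class (poly_ring X) f)"

end

theory Submission
  imports Defs "HOL-Library.Nat_Bijection" "Jordan_Normal_Form.Determinant"
begin

text \<open>
  For a chain \<open>V\<^sub>k\<close> with vertices \<open>(p\<^sub>i, q\<^sub>i)\<close> let \<open>F\<^sub>k\<close> be the determinant of the matrix with entries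
  \<open>x\<close> at \<open>(p\<^sub>i, q\<^sub>j)\<close>, read as \<open>0\<close> outside \<open>V(P)\<close>, and let \<open>f = \<Prod>k. F\<^sub>k\<close>. For the weight \<open>(x - y)\<^sup>2\<close>
  the antidiagonal terms lead, so the initial monomial of \<open>f\<close> is the product of all indeterminates.

  The cells of \<open>Q\<^sub>1\<close> contain with \<open>C + (1,0)\<close> and \<open>C + (0,1)\<close> also \<open>C\<close>. For such a collection the
  ideal is the kernel of a monomial map recording row and column segments, hence prime.
  Adding the cells by increasing level, let \<open>X\<close> consist of all cells of \<open>Q\<^sub>1\<close> below the level of a
  cell \<open>C\<close> of the chain \<open>k\<close>. Modulo \<open>I\<^bsub>X\<^esub>\<close> row operations show that a monomial times \<open>F\<^sub>k\<close> is a
  monomial times the product of the binomials of all cells of the chain. Hence \<open>I\<^bsub>X \<union> {C}\<^esub>\<close> is the colon ideal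
  \<open>(I\<^bsub>X\<^esub> + (F\<^sub>k)) : (h)\<close>, where \<open>h\<close> is the product of the binomials of the other cells of the chain
  and of the indeterminates of the lower left vertex of \<open>C\<close> and of the last vertex of the chain. The ideal of \<open>Q\<^sub>1\<close> is the sum of these ideals. For \<open>Q\<^sub>2\<close> one argues from above.
\<close>

text \<open>In general \<open>P\<close> is closed in neither direction: the hole left by
  \<open>Q'\<close> can break closure under meets at its upper right corner and closure under joins
  at its lower left corner. Cutting at \<open>b\<close> and \<open>a\<close> removes these
  configurations, and the hypothesis on the sum glues the two sides.

  A chain determinant sees all cells of its chain at once, whereas the ideal of a side needs each
  cell separately. Adjoining a single cell to all cells of lower level keeps the collection closed,
  because the cell required by closure has strictly smaller level. The enlarged ideal J is therefore
  prime, so a factor h outside J can be cancelled: J : h = J. This lets a colon ideal isolate one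
  cell of the chain.

  The weight is strictly convex in x - y. Along a chain x increases while y decreases, so by the
  rearrangement principle the pairing along the chain strictly outweighs every other, whichever
  off-diagonal entries are 0. The single F_k are recovered from their product f as (f) : (f /
  F_k).\<close>

abbreviation lookup where "lookup \<equiv> Poly_Mapping.lookup"
abbreviation keys where "keys \<equiv> Poly_Mapping.keys"
abbreviation single where "single \<equiv> Poly_Mapping.single"

lemma sum_single_lookup:
  fixes p :: "'a \<Rightarrow>\<^sub>0 'b::comm_monoid_add"
  shows "(\<Sum>x\<in>keys p. single x (lookup p x)) = p"
proof (rule poly_mapping_eqI)
  fix k
  have "lookup (\<Sum>x\<in>keys p. single x (lookup p x)) k = (\<Sum>x\<in>keys p. if x = k then lookup p x else 0)"
    by (simp add: lookup_sum lookup_single when_def)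
  also have "\<dots> = lookup p k"
    by (simp add: in_keys_iff)
  finally show "lookup (\<Sum>x\<in>keys p. single x (lookup p x)) k = lookup p k" .
qed

subsection \<open>Push-forward of finitely supported functions\<close>

text \<open>Serves at two levels: on exponent vectors it renames indeterminates, adding the
  exponents of those that become equal; on polynomials, for additive \<open>f\<close>, it is the
  ring homomorphism induced by a map of monomials.\<close>

definition push :: "('a \<Rightarrow> 'b) \<Rightarrow> ('a \<Rightarrow>\<^sub>0 'c::comm_monoid_add) \<Rightarrow> 'b \<Rightarrow>\<^sub>0 'c" where
  "push f p = (\<Sum>x\<in>keys p. single (f x) (lookup p x))"

lemma push_superset:
  assumes "finite A" "keys p \<subseteq> A"
  shows "push f p = (\<Sum>x\<in>A. single (f x) (lookup p x))"
  unfolding push_def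
  by (rule sum.mono_neutral_left) (use assms in \<open>auto simp: in_keys_iff\<close>)

lemma push_zero [simp]: "push f 0 = 0"
  by (simp add: push_def)

lemma push_single [simp]: "push f (single x c) = single (f x) c"
  by (cases "c = 0") (simp_all add: push_def)

lemma push_add: "push f (p + q) = push f p + push f q"
proof -
  let ?A = "keys p \<union> keys q"
  have "push f (p + q) = (\<Sum>x\<in>?A. single (f x) (lookup (p + q) x))"
    by (rule push_superset) (simp_all add: keys_add)
  also have "\<dots> = push f p + push f q"
    by (subst (1 2) push_superset[of ?A]) (simp_all add: lookup_add single_add sum.distrib)
  finally show ?thesis .
qed

lemma push_sum: "push f (\<Sum>i\<in>A. p i) = (\<Sum>i\<in>A. push f (p i))"
  by (induction A rule: infinite_finite_induct) (simp_all add: push_add)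

lemma push_uminus:
  fixes p :: "'a \<Rightarrow>\<^sub>0 'c::ab_group_add"
  shows "push f (- p) = - push f p"
proof -
  have "push f p + push f (- p) = 0"
    by (simp flip: push_add)
  then show ?thesis by (simp add: eq_neg_iff_add_eq_0 add.commute)
qed

lemma push_diff:
  fixes p :: "'a \<Rightarrow>\<^sub>0 'c::ab_group_add"
  shows "push f (p - q) = push f p - push f q"
  using push_add[of f p "- q"] by (simp add: push_uminus)

lemma push_mult:
  fixes p q :: "'a::comm_monoid_add \<Rightarrow>\<^sub>0 'c::comm_ring_1" and f :: "'a \<Rightarrow> 'b::comm_monoid_add"
  assumes f: "\<And>x y. f (x + y) = f x + f y"
  shows "push f (p * q) = push f p * push f q"
proof -
  have "p * q = (\<Sum>x\<in>keys p. \<Sum>y\<in>keys q. single (x + y) (lookup p x * lookup q y))"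
    by (subst (1 2) sum_single_lookup[symmetric]) (simp only: sum_product mult_single)
  then have "push f (p * q) = (\<Sum>x\<in>keys p. \<Sum>y\<in>keys q. single (f (x + y)) (lookup p x * lookup q y))"
    by (simp add: push_sum)
  also have "\<dots> = push f p * push f q"
    unfolding push_def by (simp add: sum_product mult_single f)
  finally show ?thesis .
qed

lemma lookup_push: "lookup (push f p) y = (\<Sum>x\<in>keys p. lookup p x when f x = y)"
  by (simp add: push_def lookup_sum lookup_single)

lemma lookup_push_inj:
  assumes "inj f"
  shows "lookup (push f p) (f x) = lookup p x"
proof -
  have "lookup (push f p) (f x) = (\<Sum>z\<in>keys p. if z = x then lookup p z else 0)"
    unfolding lookup_push when_def using assms by (intro sum.cong) (auto dest: injD)
  also have "\<dots> = lookup p x"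
    by (simp add: in_keys_iff)
  finally show ?thesis .
qed

lemma push_inj: "inj f \<Longrightarrow> push f p = push f q \<Longrightarrow> p = q"
  by (metis lookup_push_inj poly_mapping_eqI)

text \<open>Replacing every key by a chosen key of its fibre changes an element of the kernel into \<open>0\<close>.\<close>

lemma push_eq_0_imp_mem:
  fixes p :: "'a \<Rightarrow>\<^sub>0 'c::comm_ring_1"
  assumes p: "push f p = 0"
    and zero: "0 \<in> I" and add: "\<And>a b. a \<in> I \<Longrightarrow> b \<in> I \<Longrightarrow> a + b \<in> I"
    and fib: "\<And>x y c. x \<in> keys p \<Longrightarrow> y \<in> keys p \<Longrightarrow> f x = f y \<Longrightarrow> single x c - single y c \<in> I"
  shows "p \<in> I"
proof -
  define r where "r t = (SOME x. x \<in> keys p \<and> f x = t)" for t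
  have r: "r (f x) \<in> keys p" "f (r (f x)) = f x" if "x \<in> keys p" for x
    using someI[of "\<lambda>y. y \<in> keys p \<and> f y = f x" x] that by (auto simp: r_def)
  \<comment> \<open>This sum depends on \<open>p\<close> only through \<open>push f p\<close>, so it
    vanishes and can be subtracted from \<open>p\<close>.\<close>
  have "(\<Sum>x\<in>keys p. single (r (f x)) (lookup p x)) = push r (push f p)"
    by (simp add: push_def[of f] push_sum)
  then have "p = (\<Sum>x\<in>keys p. single x (lookup p x) - single (r (f x)) (lookup p x))"
    by (simp add: p sum_subtractf sum_single_lookup)
  moreover have "(\<Sum>x\<in>A. single x (lookup p x) - single (r (f x)) (lookup p x)) \<in> I"
    if "A \<subseteq> keys p" for A
    using finite_subset[OF that finite_keys] that
    by (induction A rule: finite_induct) (auto simp: zero intro!: add fib r(1) r(2)[symmetric])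
  ultimately show ?thesis by (metis order_refl)
qed

subsection \<open>The polynomial ring\<close>

abbreviation mon :: "'v monom \<Rightarrow> ('v, 'k::field) mpoly" where
  "mon m \<equiv> single m 1"

lemma poly_ring_simps [simp]:
  "(\<otimes>\<^bsub>poly_ring V\<^esub>) = (*)" "\<one>\<^bsub>poly_ring V\<^esub> = 1"
  "\<zero>\<^bsub>poly_ring V\<^esub> = 0" "(\<oplus>\<^bsub>poly_ring V\<^esub>) = (+)"
  by (simp_all add: poly_ring_def)

lemma carrier_poly_ring: "p \<in> carrier (poly_ring V) \<longleftrightarrow> keys p \<subseteq> monoms V"
  by (simp add: poly_ring_def)

lemma monoms_zero [simp]: "0 \<in> monoms V"
  by (simp add: monoms_def)

lemma monoms_add: "m \<in> monoms V \<Longrightarrow> n \<in> monoms V \<Longrightarrow> m + n \<in> monoms V"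
  using keys_add[of m n] by (auto simp: monoms_def)

lemma monoms_single [simp]: "single v (Suc 0) \<in> monoms V \<longleftrightarrow> v \<in> V"
  by (simp add: monoms_def)

lemma carrier_add: "p \<in> carrier (poly_ring V) \<Longrightarrow> q \<in> carrier (poly_ring V) \<Longrightarrow> p + q \<in> carrier (poly_ring V)"
  using keys_add[of p q] by (auto simp: carrier_poly_ring)

lemma carrier_uminus: "p \<in> carrier (poly_ring V) \<Longrightarrow> - p \<in> carrier (poly_ring V)"
  by (auto simp: carrier_poly_ring in_keys_iff subset_iff)

lemma carrier_diff: "p \<in> carrier (poly_ring V) \<Longrightarrow> q \<in> carrier (poly_ring V) \<Longrightarrow> p - q \<in> carrier (poly_ring V)"
  using carrier_add[of p V "- q"] by (simp add: carrier_uminus)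

lemma carrier_mult: "p \<in> carrier (poly_ring V) \<Longrightarrow> q \<in> carrier (poly_ring V) \<Longrightarrow> p * q \<in> carrier (poly_ring V)"
  using keys_mult[of p q] by (fastforce simp: carrier_poly_ring intro: monoms_add)

lemma carrier_zero [simp]: "0 \<in> carrier (poly_ring V)" and carrier_one [simp]: "1 \<in> carrier (poly_ring V)"
  by (simp_all add: carrier_poly_ring)

lemma carrier_mon [simp]: "single m c \<in> carrier (poly_ring V) \<longleftrightarrow> c = 0 \<or> m \<in> monoms V"
  by (simp add: carrier_poly_ring)

lemma carrier_indet [simp]: "indet v \<in> carrier (poly_ring V) \<longleftrightarrow> v \<in> V"
  by (simp add: indet_def)

lemma carrier_prod: "(\<And>i. i \<in> A \<Longrightarrow> p i \<in> carrier (poly_ring V)) \<Longrightarrow> (\<Prod>i\<in>A. p i) \<in> carrier (poly_ring V)"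
  by (induction A rule: infinite_finite_induct) (simp_all add: carrier_mult)

lemma carrier_sum: "(\<And>i. i \<in> A \<Longrightarrow> p i \<in> carrier (poly_ring V)) \<Longrightarrow> (\<Sum>i\<in>A. p i) \<in> carrier (poly_ring V)"
  by (induction A rule: infinite_finite_induct) (simp_all add: carrier_add)

lemmas carrier_intros = carrier_add carrier_uminus carrier_diff carrier_mult carrier_prod carrier_sum

lemma cring_poly_ring: "cring (poly_ring V :: ('v, 'k::field) mpoly ring)"
proof (rule cringI)
  show "abelian_group (poly_ring V :: ('v, 'k) mpoly ring)"
  proof (rule abelian_groupI)
    fix p :: "('v, 'k) mpoly" assume "p \<in> carrier (poly_ring V)"
    then show "\<exists>q\<in>carrier (poly_ring V). q \<oplus>\<^bsub>poly_ring V\<^esub> p = \<zero>\<^bsub>poly_ring V\<^esub>"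
      by (intro bexI[of _ "- p"]) (simp_all add: carrier_uminus)
  qed (simp_all add: carrier_add add_ac)
  show "Group.comm_monoid (poly_ring V :: ('v, 'k) mpoly ring)"
    by (rule comm_monoidI) (simp_all add: carrier_mult mult_ac)
qed (simp add: distrib_right)

locale poly_ideal =
  fixes V :: "'v set" and I :: "('v, 'k::field) mpoly set"
  assumes is_ideal: "ideal I (poly_ring V)"
begin

sublocale ideal I "poly_ring V" by (rule is_ideal)

lemma carr: "p \<in> I \<Longrightarrow> p \<in> carrier (poly_ring V)"
  by (rule Icarr)

lemma zero_mem [simp]: "0 \<in> I"
  using additive_subgroup.zero_closed[OF is_additive_subgroup] by simp

lemma add_mem: "p \<in> I \<Longrightarrow> q \<in> I \<Longrightarrow> p + q \<in> I"
  using additive_subgroup.a_closed[OF is_additive_subgroup] by simp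

lemma mult_mem: "p \<in> carrier (poly_ring V) \<Longrightarrow> q \<in> I \<Longrightarrow> p * q \<in> I"
  using I_l_closed by simp

lemma uminus_mem: "p \<in> I \<Longrightarrow> - p \<in> I"
  using mult_mem[of "- 1" p] by (simp add: carrier_uminus)

lemma diff_mem: "p \<in> I \<Longrightarrow> q \<in> I \<Longrightarrow> p - q \<in> I"
  using add_mem[of p "- q"] uminus_mem by simp

lemma sum_mem: "(\<And>i. i \<in> A \<Longrightarrow> p i \<in> I) \<Longrightarrow> (\<Sum>i\<in>A. p i) \<in> I"
  by (induction A rule: infinite_finite_induct) (simp_all add: add_mem)

lemma diff_mem_iff: "p - q \<in> I \<Longrightarrow> p \<in> I \<longleftrightarrow> q \<in> I"
  using add_mem[of "p - q" q] diff_mem[of p "p - q"] by auto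

end

subsection \<open>Ideals given by two labellings of the indeterminates\<close>

text \<open>Even indices carry the labels \<open>h\<close>, odd ones the labels \<open>w\<close>, so
  \<open>nat\<close> acts as a disjoint union. With indeterminates indexed by \<open>nat\<close> the
  monomials are linearly ordered, and the target ring is a domain.\<close>

definition label_monom :: "('v \<Rightarrow> nat) \<Rightarrow> ('v \<Rightarrow> nat) \<Rightarrow> 'v monom \<Rightarrow> nat monom" where
  "label_monom h w m = push (\<lambda>x. 2 * h x) m + push (\<lambda>x. 2 * w x + 1) m"

lemma label_monom_add: "label_monom h w (m + n) = label_monom h w m + label_monom h w n"
  by (simp add: label_monom_def push_add algebra_simps)

lemma lookup_label_monom:
  "lookup (label_monom h w m) (2 * k) = (\<Sum>x\<in>keys m. lookup m x when h x = k)"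
  "lookup (label_monom h w m) (Suc (2 * k)) = (\<Sum>x\<in>keys m. lookup m x when w x = k)"
proof -
  have "2 * a \<noteq> Suc (2 * b)" "Suc (2 * b) \<noteq> 2 * a" for a b :: nat
    by presburger+
  then show "lookup (label_monom h w m) (2 * k) = (\<Sum>x\<in>keys m. lookup m x when h x = k)"
    "lookup (label_monom h w m) (Suc (2 * k)) = (\<Sum>x\<in>keys m. lookup m x when w x = k)"
    by (simp_all add: label_monom_def lookup_add lookup_push)
qed

text \<open>Exponents are natural numbers, so nothing cancels in the image: a label borne in one
  monomial must also be borne in the other.\<close>

lemma label_monom_eq_imp:
  assumes "label_monom h w m = label_monom h w n" "b \<in> keys m"
  shows "\<exists>c\<in>keys n. h c = h b" "\<exists>d\<in>keys n. w d = w b"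
proof -
  have pos: "0 < (\<Sum>x\<in>keys m. lookup m x when u x = u b)" for u :: "'a \<Rightarrow> nat"
    using assms(2) by (intro sum_pos2[of _ b]) (auto simp: in_keys_iff when_def)
  have ex: "\<exists>c\<in>keys n. u c = k" if "0 < (\<Sum>x\<in>keys n. lookup n x when u x = k)" for u :: "'a \<Rightarrow> nat" and k
  proof (rule ccontr)
    assume "\<not> (\<exists>c\<in>keys n. u c = k)"
    then have "(\<Sum>x\<in>keys n. lookup n x when u x = k) = 0"
      by (intro sum.neutral) auto
    with that show False by simp
  qed
  show "\<exists>c\<in>keys n. h c = h b"
    using pos[of h] lookup_label_monom(1)[of h w _ "h b"] assms(1) by (intro ex) metis
  show "\<exists>d\<in>keys n. w d = w b"
    using pos[of w] lookup_label_monom(2)[of h w _ "w b"] assms(1) by (intro ex) metis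
qed

definition total_deg :: "'v monom \<Rightarrow> nat" where
  "total_deg m = lookup (push (\<lambda>_. ()) m) ()"

lemma total_deg_add [simp]: "total_deg (m + n) = total_deg m + total_deg n"
  by (simp add: total_deg_def push_add lookup_add)

lemma total_deg_single [simp]: "total_deg (single x c) = c"
  by (simp add: total_deg_def)

lemma monom_remove:
  fixes m :: "'v monom"
  assumes "b \<in> keys m"
  obtains n where "m = n + single b 1"
proof
  have "0 < lookup m b" using assms by (simp add: in_keys_iff)
  then show "m = (m - single b 1) + single b 1"
    by (intro poly_mapping_eqI) (auto simp: lookup_add lookup_minus lookup_single when_def)
qed

lemma keys_add_nat: "keys (m + n) = keys m \<union> keys (n :: 'v \<Rightarrow>\<^sub>0 nat)"
  by (auto simp: in_keys_iff lookup_add)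

lemma monoms_add_iff [simp]: "m + n \<in> monoms V \<longleftrightarrow> m \<in> monoms V \<and> n \<in> monoms V"
  by (auto simp: monoms_def keys_add_nat)

text \<open>
  A vertex \<open>b\<close> of maximal level that occurs in one of two monomials with equal labels can be moved
  into the other one by a single exchange, after which it can be cancelled.
\<close>

lemma (in poly_ideal) label_monom_eq_imp_mem:
  fixes lev :: "'v \<Rightarrow> int"
  assumes inj: "\<And>x y. h x = h y \<Longrightarrow> w x = w y \<Longrightarrow> x = y"
    and swap: "\<And>b c d. b \<in> V \<Longrightarrow> c \<in> V \<Longrightarrow> d \<in> V \<Longrightarrow> h c = h b \<Longrightarrow> w d = w b \<Longrightarrow> c \<noteq> b \<Longrightarrow> d \<noteq> b \<Longrightarrow>
      lev c \<le> lev b \<Longrightarrow> lev d \<le> lev b \<Longrightarrow>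
      \<exists>u\<in>V. indet u * indet b - indet c * indet d \<in> I \<and> h u = h d \<and> w u = w c"
  shows "m \<in> monoms V \<Longrightarrow> m' \<in> monoms V \<Longrightarrow> label_monom h w m = label_monom h w m' \<Longrightarrow> mon m - mon m' \<in> I"
proof (induction "total_deg m + total_deg m'" arbitrary: m m' rule: less_induct)
  case less
  \<comment> \<open>Stated for arbitrary monomials with their own induction hypothesis, since the
    vertex of maximal level may occur in either of the two.\<close>
  have step: "mon m - mon m' \<in> I"
    if b: "b \<in> keys m" and max: "\<And>x. x \<in> keys m \<union> keys m' \<Longrightarrow> lev x \<le> lev b"
      and V: "m \<in> monoms V" "m' \<in> monoms V" and eq: "label_monom h w m = label_monom h w m'"
      and IH: "\<And>n n'. total_deg n + total_deg n' < total_deg m + total_deg m' \<Longrightarrow> n \<in> monoms V \<Longrightarrow>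
          n' \<in> monoms V \<Longrightarrow> label_monom h w n = label_monom h w n' \<Longrightarrow> mon n - mon n' \<in> I"
    for m m' b
  proof -
    obtain n where n: "m = n + single b 1" using b by (rule monom_remove)
    have cancel: "mon m - mon (n' + single b 1) \<in> I"
      if "n' \<in> monoms V" "label_monom h w (n' + single b 1) = label_monom h w m"
        "total_deg n' < total_deg m'" for n'
    proof -
      have "mon n - mon n' \<in> I"
        using that V by (intro IH) (auto simp: n label_monom_add)
      then have "mon (single b 1) * (mon n - mon n') \<in> I"
        using V by (intro mult_mem) (auto simp: n)
      then show ?thesis
        by (simp add: n algebra_simps mult_single)
    qed
    obtain c d where c: "c \<in> keys m'" "h c = h b" and d: "d \<in> keys m'" "w d = w b"
      using label_monom_eq_imp[OF eq b] by auto
    show ?thesis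
    proof (cases "b \<in> keys m'")
      case True
      then obtain n' where n': "m' = n' + single b 1" by (rule monom_remove)
      show ?thesis
        using cancel[of n'] V eq by (simp add: n')
    next
      case False
      then have ne: "c \<noteq> b" "d \<noteq> b" using c d by auto
      \<comment> \<open>A common vertex would carry both labels of \<open>b\<close> and hence equal
        \<open>b\<close>.\<close>
      then have "c \<noteq> d" using inj c d by metis
      obtain r0 where r0: "m' = r0 + single d 1" using d(1) by (rule monom_remove)
      then have "c \<in> keys r0"
        using c \<open>c \<noteq> d\<close> by (auto simp: keys_add_nat)
      then obtain r where r: "r0 = r + single c 1" by (rule monom_remove)
      have inV: "b \<in> V" "c \<in> V" "d \<in> V"
        using V b c d by (auto simp: monoms_def)
      obtain u where u: "u \<in> V" "indet u * indet b - indet c * indet d \<in> I" "h u = h d" "w u = w c"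
        using swap[OF inV c(2) d(2) ne] max c d by auto
      \<comment> \<open>\<open>b\<close> has the \<open>h\<close> label of \<open>c\<close> and the
        \<open>w\<close> label of \<open>d\<close>, and \<open>u\<close> has the two others, so
        trading \<open>c\<close>, \<open>d\<close> for \<open>u\<close>, \<open>b\<close> preserves
        all labels.\<close>
      have "label_monom h w (r + single u 1 + single b 1) = label_monom h w m'"
        by (simp add: r0 r label_monom_add) (simp add: label_monom_def u c d add_ac)
      then have "mon m - mon (r + single u 1 + single b 1) \<in> I"
        using V u eq by (intro cancel) (auto simp: r r0)
      moreover have "mon r * (indet u * indet b - indet c * indet d) \<in> I"
        using u V by (intro mult_mem) (auto simp: r r0)
      then have "mon (r + single u 1 + single b 1) - mon m' \<in> I"
        by (simp add: indet_def mult_single r r0 algebra_simps)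
      ultimately show ?thesis using add_mem by fastforce
    qed
  qed
  show ?case
  proof (cases "keys m \<union> keys m' = {}")
    case True
    then have "m = 0" "m' = 0" by auto
    then show ?thesis by simp
  next
    case False
    have fin: "finite (lev ` (keys m \<union> keys m'))" by simp
    have "Max (lev ` (keys m \<union> keys m')) \<in> lev ` (keys m \<union> keys m')"
      using Max_in[OF fin] False by blast
    then obtain b where b: "b \<in> keys m \<union> keys m'" "lev b = Max (lev ` (keys m \<union> keys m'))"
      by (metis imageE)
    have max: "lev x \<le> lev b" if "x \<in> keys m \<union> keys m'" for x
      unfolding b(2) using that fin by (intro Max_ge) auto
    show ?thesis
    proof (cases "b \<in> keys m")
      case True
      show ?thesis
        by (rule step[OF True max]) (use less in auto)
    next
      case False
      with b have "b \<in> keys m'" by auto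
      then have "mon m' - mon m \<in> I"
        by (rule step) (use less max in \<open>auto simp: add.commute\<close>)
      then show ?thesis using uminus_mem by fastforce
    qed
  qed
qed

subsection \<open>Inner intervals and minors\<close>

text \<open>Meaningful for coordinates in any order: exchanging two rows or columns changes the
  sign, and equal ones give 0. Rectangles spanned in different directions can thus be treated
  alike.\<close>

definition minor :: "nat \<Rightarrow> nat \<Rightarrow> nat \<Rightarrow> nat \<Rightarrow> (point, 'k::field) mpoly" where
  "minor x1 x2 y1 y2 = indet (x1, y1) * indet (x2, y2) - indet (x1, y2) * indet (x2, y1)"

lemma minor_swap: "minor x2 x1 y1 y2 = - minor x1 x2 y1 y2" "minor x1 x2 y2 y1 = - minor x1 x2 y1 y2"
  by (simp_all add: minor_def)

lemma minor_same [simp]: "minor x x y1 y2 = 0" "minor x1 x2 y y = 0"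
  by (simp_all add: minor_def)

lemma cell_vertices_eq: "cell_vertices (x, y) = {(x, y), (Suc x, y), (x, Suc y), (Suc x, Suc y)}"
  by (simp add: cell_vertices_def lower_left_def lower_right_def upper_left_def upper_right_def)

lemma interval_cells_eq: "interval_cells (x1, y1) (x2, y2) = {x1..<x2} \<times> {y1..<y2}"
  by (auto simp: interval_cells_def cell_vertices_eq less_eq_prod_def)

lemma mem_vertices_iff:
  "(x, y) \<in> vertices X \<longleftrightarrow> (x, y) \<in> X \<or> (0 < x \<and> (x - 1, y) \<in> X) \<or>
     (0 < y \<and> (x, y - 1) \<in> X) \<or> (0 < x \<and> 0 < y \<and> (x - 1, y - 1) \<in> X)"
proof
  assume "(x, y) \<in> vertices X"
  then show "(x, y) \<in> X \<or> (0 < x \<and> (x - 1, y) \<in> X) \<or>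
     (0 < y \<and> (x, y - 1) \<in> X) \<or> (0 < x \<and> 0 < y \<and> (x - 1, y - 1) \<in> X)"
    by (auto simp: vertices_def cell_vertices_eq)
next
  assume "(x, y) \<in> X \<or> (0 < x \<and> (x - 1, y) \<in> X) \<or>
     (0 < y \<and> (x, y - 1) \<in> X) \<or> (0 < x \<and> 0 < y \<and> (x - 1, y - 1) \<in> X)"
  then show "(x, y) \<in> vertices X"
    unfolding vertices_def
    by (elim disjE conjE) (rule UN_I, assumption, simp add: cell_vertices_eq)+
qed

lemma vertices_mono: "X \<subseteq> Y \<Longrightarrow> vertices X \<subseteq> vertices Y"
  by (auto simp: vertices_def)

lemma rect_vertices:
  assumes "x1 < x2" "y1 < y2" "{x1..<x2} \<times> {y1..<y2} \<subseteq> X"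
  shows "(x1, y1) \<in> vertices X" "(x1, y2) \<in> vertices X" "(x2, y1) \<in> vertices X" "(x2, y2) \<in> vertices X"
proof -
  have "(x1, y1) \<in> X" "(x2 - 1, y1) \<in> X" "(x1, y2 - 1) \<in> X" "(x2 - 1, y2 - 1) \<in> X"
    using assms by auto
  with assms(1,2) show "(x1, y1) \<in> vertices X" "(x1, y2) \<in> vertices X" "(x2, y1) \<in> vertices X"
    "(x2, y2) \<in> vertices X"
    by (auto simp: mem_vertices_iff)
qed

lemma inner_interval_iff:
  "inner_interval X (x1, y1) (x2, y2) \<longleftrightarrow> x1 < x2 \<and> y1 < y2 \<and> {x1..<x2} \<times> {y1..<y2} \<subseteq> X"
  using rect_vertices[of x1 x2 y1 y2 X]
  by (auto simp: inner_interval_def proper_interval_def interval_cells_eq)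

lemma inner_binomials_eq:
  "inner_binomials X = {minor x1 x2 y1 y2 | x1 x2 y1 y2. x1 < x2 \<and> y1 < y2 \<and> {x1..<x2} \<times> {y1..<y2} \<subseteq> X}"
  by (auto simp: inner_binomials_def inner_interval_iff minor_def)

lemma minor_carrier:
  "(x1, y1) \<in> V \<Longrightarrow> (x1, y2) \<in> V \<Longrightarrow> (x2, y1) \<in> V \<Longrightarrow> (x2, y2) \<in> V \<Longrightarrow> minor x1 x2 y1 y2 \<in> carrier (poly_ring V)"
  by (simp add: minor_def carrier_intros)

lemma inner_binomials_carrier:
  assumes "vertices X \<subseteq> V"
  shows "inner_binomials X \<subseteq> carrier (poly_ring V)"
proof
  fix p assume "p \<in> inner_binomials X"
  then obtain x1 x2 y1 y2 where "p = minor x1 x2 y1 y2" "x1 < x2" "y1 < y2" "{x1..<x2} \<times> {y1..<y2} \<subseteq> X"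
    by (auto simp: inner_binomials_eq)
  then show "p \<in> carrier (poly_ring V)"
    using rect_vertices[of x1 x2 y1 y2 X] assms by (auto intro!: minor_carrier)
qed

lemma poly_ideal_polyomino_ideal:
  assumes "vertices X \<subseteq> V"
  shows "poly_ideal V (polyomino_ideal (poly_ring V) X)"
  unfolding polyomino_ideal_def poly_ideal_def
  by (intro ring.genideal_ideal cring.axioms(1) cring_poly_ring inner_binomials_carrier assms)

lemma inner_binomials_subset_ideal:
  assumes "vertices X \<subseteq> V"
  shows "inner_binomials X \<subseteq> polyomino_ideal (poly_ring V) X"
  unfolding polyomino_ideal_def
  by (intro ring.genideal_self cring.axioms(1) cring_poly_ring inner_binomials_carrier assms)

lemma polyomino_ideal_minimal:
  assumes "ideal I (poly_ring V)" "inner_binomials X \<subseteq> I"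
  shows "polyomino_ideal (poly_ring V) X \<subseteq> I"
  unfolding polyomino_ideal_def
  by (intro ring.genideal_minimal cring.axioms(1) cring_poly_ring assms)

lemma inner_binomials_mono: "X \<subseteq> Y \<Longrightarrow> inner_binomials X \<subseteq> inner_binomials Y"
  by (fastforce simp: inner_binomials_eq)

lemma polyomino_ideal_mono:
  assumes "X \<subseteq> Y" "vertices Y \<subseteq> V"
  shows "polyomino_ideal (poly_ring V) X \<subseteq> polyomino_ideal (poly_ring V) Y"
  using poly_ideal_polyomino_ideal[OF assms(2)] inner_binomials_subset_ideal[OF assms(2)]
    inner_binomials_mono[OF assms(1)]
  by (intro polyomino_ideal_minimal) (auto simp: poly_ideal_def)

lemma minor_mem_polyomino_ideal:
  assumes V: "vertices X \<subseteq> V" and X: "{min x1 x2..<max x1 x2} \<times> {min y1 y2..<max y1 y2} \<subseteq> X"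
  shows "minor x1 x2 y1 y2 \<in> polyomino_ideal (poly_ring V) X"
proof -
  interpret poly_ideal V "polyomino_ideal (poly_ring V) X"
    using V by (rule poly_ideal_polyomino_ideal)
  have le: "minor x1 x2 y1 y2 \<in> polyomino_ideal (poly_ring V) X"
    if "x1 \<le> x2" "y1 \<le> y2" "{x1..<x2} \<times> {y1..<y2} \<subseteq> X" for x1 x2 y1 y2
  proof (cases "x1 = x2 \<or> y1 = y2")
    case True
    then show ?thesis by auto
  next
    case False
    with that have "x1 < x2" "y1 < y2" by auto
    with that(3) have "minor x1 x2 y1 y2 \<in> inner_binomials X"
      unfolding inner_binomials_eq by blast
    then show ?thesis using inner_binomials_subset_ideal[OF V] by auto
  qed
  have "minor (min x1 x2) (max x1 x2) (min y1 y2) (max y1 y2) \<in> polyomino_ideal (poly_ring V) X"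
    using X by (intro le) auto
  moreover have "minor x1 x2 y1 y2 = minor (min x1 x2) (max x1 x2) (min y1 y2) (max y1 y2) \<or>
      minor x1 x2 y1 y2 = - minor (min x1 x2) (max x1 x2) (min y1 y2) (max y1 y2)"
    by (simp add: min_def max_def minor_def)
  ultimately show ?thesis using uminus_mem by metis
qed

subsection \<open>Labelling vertices by the rows and columns of a collection of cells\<close>

text \<open>The unit segment from \<open>(x, y)\<close> to the right borders a cell of
  \<open>X\<close>, lying above or below it; \<open>vedge\<close> is the analogue for the segment
  upwards.\<close>

definition hedge :: "cell set \<Rightarrow> nat \<Rightarrow> nat \<Rightarrow> bool" where
  "hedge X x y \<longleftrightarrow> (x, y) \<in> X \<or> 0 < y \<and> (x, y - 1) \<in> X"

definition vedge :: "cell set \<Rightarrow> nat \<Rightarrow> nat \<Rightarrow> bool" where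
  "vedge X x y \<longleftrightarrow> (x, y) \<in> X \<or> 0 < x \<and> (x - 1, y) \<in> X"

text \<open>
  Counting the gaps to the left of (below) a vertex labels the maximal segments of its row (column).
\<close>

definition hlabel :: "cell set \<Rightarrow> point \<Rightarrow> nat" where
  "hlabel X v = prod_encode (card {x. x < fst v \<and> \<not> hedge X x (snd v)}, snd v)"

definition vlabel :: "cell set \<Rightarrow> point \<Rightarrow> nat" where
  "vlabel X v = prod_encode (fst v, card {y. y < snd v \<and> \<not> vedge X (fst v) y})"

lemma card_gaps_eq_iff:
  fixes m n :: nat
  assumes "m \<le> n"
  shows "card {x. x < m \<and> \<not> E x} = card {x. x < n \<and> \<not> E x} \<longleftrightarrow> (\<forall>x\<in>{m..<n}. E x)"
proof -
  have "card {x. x < n \<and> \<not> E x} = card ({x. x < m \<and> \<not> E x} \<union> {x\<in>{m..<n}. \<not> E x})"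
    using assms by (intro arg_cong[of _ _ card]) auto
  also have "\<dots> = card {x. x < m \<and> \<not> E x} + card {x\<in>{m..<n}. \<not> E x}"
    by (rule card_Un_disjoint) auto
  finally have "card {x. x < m \<and> \<not> E x} = card {x. x < n \<and> \<not> E x} \<longleftrightarrow> card {x\<in>{m..<n}. \<not> E x} = 0"
    by linarith
  also have "\<dots> \<longleftrightarrow> {x\<in>{m..<n}. \<not> E x} = {}"
    by (subst card_0_eq) auto
  finally have "card {x. x < m \<and> \<not> E x} = card {x. x < n \<and> \<not> E x} \<longleftrightarrow> {x\<in>{m..<n}. \<not> E x} = {}" .
  then show ?thesis by auto
qed

lemma hlabel_eq_iff:
  "x1 \<le> x2 \<Longrightarrow> hlabel X (x1, y1) = hlabel X (x2, y2) \<longleftrightarrow> y1 = y2 \<and> (\<forall>x\<in>{x1..<x2}. hedge X x y2)"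
  using card_gaps_eq_iff[of x1 x2 "\<lambda>x. hedge X x y2"] by (auto simp: hlabel_def)

lemma vlabel_eq_iff:
  "y1 \<le> y2 \<Longrightarrow> vlabel X (x1, y1) = vlabel X (x2, y2) \<longleftrightarrow> x1 = x2 \<and> (\<forall>y\<in>{y1..<y2}. vedge X x2 y)"
  using card_gaps_eq_iff[of y1 y2 "\<lambda>y. vedge X x2 y"] by (auto simp: vlabel_def)

lemma labels_inj: "hlabel X u = hlabel X v \<Longrightarrow> vlabel X u = vlabel X v \<Longrightarrow> u = v"
  by (auto simp: hlabel_def vlabel_def prod_eq_iff)

text \<open>Each unit segment on the boundary of the rectangle borders one of its cells, so no gap
  separates adjacent corners.\<close>

lemma rect_labels:
  assumes "x1 < x2" "y1 < y2" "{x1..<x2} \<times> {y1..<y2} \<subseteq> X"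
  shows "hlabel X (x1, y1) = hlabel X (x2, y1)" "hlabel X (x1, y2) = hlabel X (x2, y2)"
    "vlabel X (x1, y1) = vlabel X (x1, y2)" "vlabel X (x2, y1) = vlabel X (x2, y2)"
proof -
  have X: "(x, y) \<in> X" if "x1 \<le> x" "x < x2" "y1 \<le> y" "y < y2" for x y
    using assms(3) that by auto
  show "hlabel X (x1, y1) = hlabel X (x2, y1)" "hlabel X (x1, y2) = hlabel X (x2, y2)"
    using assms(1,2) by (auto simp: hlabel_eq_iff hedge_def X)
  show "vlabel X (x1, y1) = vlabel X (x1, y2)" "vlabel X (x2, y1) = vlabel X (x2, y2)"
    using assms(1,2) by (auto simp: vlabel_eq_iff vedge_def X)
qed

text \<open>No unit segment at \<open>b\<close> borders a cell of \<open>X\<close>, so the row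
  segment of \<open>b\<close> is a single point.\<close>

lemma hlabel_isolated:
  assumes "b \<notin> vertices X" "hlabel X c = hlabel X b"
  shows "c = b"
proof (rule ccontr)
  obtain x1 y1 x2 y2 where bc: "b = (x2, y2)" "c = (x1, y1)" by fastforce
  assume "c \<noteq> b"
  then consider "x1 < x2" | "x2 < x1"
    using assms(2) hlabel_eq_iff[of x1 x2 X y1 y2] bc by fastforce
  then show False
  proof cases
    case 1
    then have "hedge X (x2 - 1) y2"
      using assms(2) bc by (auto simp: hlabel_eq_iff)
    then show False using assms(1) 1 bc by (auto simp: hedge_def mem_vertices_iff)
  next
    case 2
    then have "y1 = y2" "hedge X x2 y2"
      using assms(2)[symmetric] bc by (auto simp: hlabel_eq_iff)
    then show False using assms(1) 2 bc by (auto simp: hedge_def mem_vertices_iff)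
  qed
qed

subsection \<open>Locally closed collections of cells\<close>

text \<open>
  The Boolean \<open>s\<close> selects one of two mirror-image situations: collections built upwards from the
  lower left (\<open>True\<close>) and collections built downwards from the upper right (\<open>False\<close>).
\<close>

definition loc_closed :: "bool \<Rightarrow> cell set \<Rightarrow> bool" where
  "loc_closed s X \<longleftrightarrow> (\<forall>x y. (x, Suc y) \<in> X \<and> (Suc x, y) \<in> X \<longrightarrow> (if s then (x, y) else (Suc x, Suc y)) \<in> X)"

lemma loc_closed_TrueD: "loc_closed True X \<Longrightarrow> (x, Suc y) \<in> X \<Longrightarrow> (Suc x, y) \<in> X \<Longrightarrow> (x, y) \<in> X"
  unfolding loc_closed_def if_True by blast

lemma loc_closed_FalseD: "loc_closed False X \<Longrightarrow> (x, Suc y) \<in> X \<Longrightarrow> (Suc x, y) \<in> X \<Longrightarrow> (Suc x, Suc y) \<in> X"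
  unfolding loc_closed_def if_False by blast

definition lev :: "bool \<Rightarrow> point \<Rightarrow> int" where
  "lev s v = (if s then int (fst v + snd v) else - int (fst v + snd v))"

text \<open>Induction from the corner \<open>(x2, y2)\<close>: unless the cell itself is in
  \<open>X\<close>, its right and upper neighbours are, and closedness yields the cell. Along the
  two sides the edge condition offers the cell or its neighbour just outside the rectangle, and
  either suffices.\<close>

lemma meet_closed_rect:
  assumes X: "loc_closed True X"
    and h: "\<forall>x\<in>{x1..<x2}. hedge X x y2" and v: "\<forall>y\<in>{y1..<y2}. vedge X x2 y"
  shows "x1 \<le> x \<Longrightarrow> x < x2 \<Longrightarrow> y1 \<le> y \<Longrightarrow> y < y2 \<Longrightarrow> (x, y) \<in> X"
proof (induction "(x2 - x) + (y2 - y)" arbitrary: x y rule: less_induct)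
  case less
  have "(x, y) \<in> X \<or> (Suc x, y) \<in> X"
  proof (cases "Suc x = x2")
    case True
    have "vedge X x2 y" using v less.prems by simp
    then show ?thesis by (auto simp: vedge_def simp flip: True)
  next
    case False
    then show ?thesis using less.hyps[of "Suc x" y] less.prems by auto
  qed
  moreover have "(x, y) \<in> X \<or> (x, Suc y) \<in> X"
  proof (cases "Suc y = y2")
    case True
    have "hedge X x y2" using h less.prems by simp
    then show ?thesis by (auto simp: hedge_def simp flip: True)
  next
    case False
    then show ?thesis using less.hyps[of x "Suc y"] less.prems by auto
  qed
  ultimately show ?case using loc_closed_TrueD[OF X] by blast
qed

text \<open>The mirror image: here \<open>(x2, y2)\<close> is the lower left corner, and the
  induction moves away from it.\<close>

lemma join_closed_rect:
  assumes X: "loc_closed False X"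
    and h: "\<forall>x\<in>{x2..<x1}. hedge X x y2" and v: "\<forall>y\<in>{y2..<y1}. vedge X x2 y"
  shows "x2 \<le> x \<Longrightarrow> x < x1 \<Longrightarrow> y2 \<le> y \<Longrightarrow> y < y1 \<Longrightarrow> (x, y) \<in> X"
proof (induction "x + y" arbitrary: x y rule: less_induct)
  case less
  have a: "(x, y) \<in> X \<or> 0 < x \<and> (x - 1, y) \<in> X"
  proof (cases "x = x2")
    case True
    have "vedge X x2 y" using v less.prems by simp
    then show ?thesis by (auto simp: vedge_def True)
  next
    case False
    then show ?thesis using less.hyps[of "x - 1" y] less.prems by auto
  qed
  have b: "(x, y) \<in> X \<or> 0 < y \<and> (x, y - 1) \<in> X"
  proof (cases "y = y2")
    case True
    have "hedge X x y2" using h less.prems by simp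
    then show ?thesis by (auto simp: hedge_def True)
  next
    case False
    then show ?thesis using less.hyps[of x "y - 1"] less.prems by auto
  qed
  show ?case
  proof (rule ccontr)
    assume "(x, y) \<notin> X"
    with a b obtain x' y' where "x = Suc x'" "y = Suc y'" "(x', Suc y') \<in> X" "(Suc x', y') \<in> X"
      by (cases x; cases y) auto
    with loc_closed_FalseD[OF X] \<open>(x, y) \<notin> X\<close> show False by blast
  qed
qed

subsection \<open>The ideal of a locally closed collection is the kernel of a monomial map\<close>

abbreviation seg_monom :: "cell set \<Rightarrow> point monom \<Rightarrow> nat monom" where
  "seg_monom X \<equiv> label_monom (hlabel X) (vlabel X)"

lemma inner_binomials_push:
  assumes "p \<in> inner_binomials X"
  shows "push (seg_monom X) p = 0"
proof -
  obtain x1 x2 y1 y2 where p: "p = minor x1 x2 y1 y2"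
    and r: "x1 < x2" "y1 < y2" "{x1..<x2} \<times> {y1..<y2} \<subseteq> X"
    using assms by (auto simp: inner_binomials_eq)
  have "seg_monom X (single (x1, y1) 1 + single (x2, y2) 1) = seg_monom X (single (x1, y2) 1 + single (x2, y1) 1)"
    using rect_labels[OF r] by (simp add: label_monom_def push_add add_ac)
  then show ?thesis
    by (simp add: p minor_def indet_def mult_single push_diff)
qed

lemma polyomino_ideal_push:
  fixes p :: "(point, 'k::field) mpoly"
  assumes V: "vertices X \<subseteq> V" and p: "p \<in> polyomino_ideal (poly_ring V) X"
  shows "push (seg_monom X) p = 0"
proof -
  let ?K = "{p \<in> carrier (poly_ring V). push (seg_monom X) p = 0} :: (point, 'k) mpoly set"
  interpret cring "poly_ring V :: (point, 'k) mpoly ring" by (rule cring_poly_ring)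
  have "ideal ?K (poly_ring V)"
  proof (rule idealI)
    show "ring (poly_ring V :: (point, 'k) mpoly ring)" by (rule ring_axioms)
    show "subgroup ?K (add_monoid (poly_ring V))"
    proof (rule add.subgroupI)
      fix a assume "a \<in> ?K"
      moreover from this have "\<ominus>\<^bsub>poly_ring V\<^esub> a = - a"
        using minus_equality[of "- a" a] by (auto simp: carrier_uminus)
      ultimately show "\<ominus>\<^bsub>poly_ring V\<^esub> a \<in> ?K"
        by (simp add: carrier_uminus push_uminus)
    qed (auto simp: push_add carrier_add intro!: exI[of _ 0])
  qed (auto simp: push_mult label_monom_add carrier_mult)
  moreover have "inner_binomials X \<subseteq> ?K"
    using inner_binomials_carrier[OF V] inner_binomials_push by auto
  ultimately have "polyomino_ideal (poly_ring V) X \<subseteq> ?K"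
    by (rule polyomino_ideal_minimal)
  with p show ?thesis by auto
qed

text \<open>The exchange in \<open>label_monom_eq_imp_mem\<close> happens in a rectangle. Maximality
  of the level at \<open>b\<close> places \<open>c\<close> in its row and \<open>d\<close> in its
  column on the side where local closedness fills the rectangle with cells; \<open>u\<close> is the
  corner opposite to \<open>b\<close>.\<close>

lemma polyomino_ideal_iff:
  fixes p :: "(point, 'k::field) mpoly"
  assumes V: "vertices X \<subseteq> V" and X: "loc_closed s X" and p: "p \<in> carrier (poly_ring V)"
  shows "p \<in> polyomino_ideal (poly_ring V) X \<longleftrightarrow> push (seg_monom X) p = 0"
proof
  assume "p \<in> polyomino_ideal (poly_ring V) X"
  then show "push (seg_monom X) p = 0" using V polyomino_ideal_push by blast
next
  interpret poly_ideal V "polyomino_ideal (poly_ring V) X"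
    using V by (rule poly_ideal_polyomino_ideal)
  assume "push (seg_monom X) p = 0"
  then show "p \<in> polyomino_ideal (poly_ring V) X"
  proof (rule push_eq_0_imp_mem)
    fix m m' and c :: 'k
    assume m: "m \<in> keys p" "m' \<in> keys p" "seg_monom X m = seg_monom X m'"
    have "mon m - mon m' \<in> polyomino_ideal (poly_ring V) X"
    proof (rule label_monom_eq_imp_mem[of "hlabel X" "vlabel X" "lev s"])
      fix u v assume "hlabel X u = hlabel X v" "vlabel X u = vlabel X v"
      then show "u = v" by (rule labels_inj)
    next
      fix b c d :: point
      assume A: "b \<in> V" "hlabel X c = hlabel X b" "vlabel X d = vlabel X b" "c \<noteq> b" "d \<noteq> b"
        "lev s c \<le> lev s b" "lev s d \<le> lev s b"
      obtain x1 y1 x2 y2 where b: "b = (x2, y2)" and c: "c = (x1, y2)" and d: "d = (x2, y1)"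
        using A(2,3) by (cases b; cases c; cases d) (auto simp: hlabel_def vlabel_def)
      let ?R = "{min x1 x2..<max x1 x2} \<times> {min y1 y2..<max y1 y2}"
      have ne: "x1 \<noteq> x2" "y1 \<noteq> y2" using A b c d by auto
      have R: "?R \<subseteq> X"
      proof (cases s)
        case True
        then have l: "x1 < x2" "y1 < y2" using A b c d by (auto simp: lev_def)
        then have "(x, y) \<in> X" if "x1 \<le> x" "x < x2" "y1 \<le> y" "y < y2" for x y
          using that A(2,3) X True
          by (intro meet_closed_rect[of X x1 x2 y2 y1]) (auto simp: b c d hlabel_eq_iff vlabel_eq_iff)
        with l show ?thesis by auto
      next
        case False
        then have l: "x2 < x1" "y2 < y1" using A b c d by (auto simp: lev_def)
        then have "(x, y) \<in> X" if "x2 \<le> x" "x < x1" "y2 \<le> y" "y < y1" for x y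
          using that A(2,3)[symmetric] X False
          by (intro join_closed_rect[of X x2 x1 y2 y1]) (auto simp: b c d hlabel_eq_iff vlabel_eq_iff)
        with l show ?thesis by auto
      qed
      have lt: "min x1 x2 < max x1 x2" "min y1 y2 < max y1 y2" using ne by auto
      have "(x1, y1) \<in> V"
        using rect_vertices[OF lt R] V by (auto simp: min_def max_def split: if_splits)
      moreover have "hlabel X (x1, y1) = hlabel X d" "vlabel X (x1, y1) = vlabel X c"
        using rect_labels[OF lt R] by (auto simp: min_def max_def c d split: if_splits)
      moreover have "indet (x1, y1) * indet b - indet c * indet d \<in> polyomino_ideal (poly_ring V) X"
        using minor_mem_polyomino_ideal[OF V R] by (simp add: minor_def b c d)
      ultimately show "\<exists>u\<in>V. indet u * indet b - indet c * indet d \<in> polyomino_ideal (poly_ring V) X \<and>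
          hlabel X u = hlabel X d \<and> vlabel X u = vlabel X c"
        by blast
    qed (use m p in \<open>auto simp: carrier_poly_ring\<close>)
    then have "single 0 c * (mon m - mon m') \<in> polyomino_ideal (poly_ring V) X"
      by (intro mult_mem) simp_all
    then show "single m c - single m' c \<in> polyomino_ideal (poly_ring V) X"
      by (simp add: algebra_simps mult_single)
  qed (simp_all add: add_mem)
qed

text \<open>The kernel of a homomorphism into a domain.\<close>

corollary polyomino_ideal_prime:
  assumes "vertices X \<subseteq> V" "loc_closed s X" "p \<in> carrier (poly_ring V)" "q \<in> carrier (poly_ring V)"
    and "p * q \<in> polyomino_ideal (poly_ring V) X"
  shows "p \<in> polyomino_ideal (poly_ring V) X \<or> q \<in> polyomino_ideal (poly_ring V) X"
  using assms by (simp add: polyomino_ideal_iff carrier_mult push_mult label_monom_add)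

text \<open>The monomial map sends monomials to monomials, never to 0. For \<open>m = 0\<close> this
  says that the ideal is proper.\<close>

lemma mon_notin_polyomino_ideal:
  assumes "vertices X \<subseteq> V"
  shows "(mon m :: (point, 'k::field) mpoly) \<notin> polyomino_ideal (poly_ring V) X"
proof
  assume "(mon m :: (point, 'k) mpoly) \<in> polyomino_ideal (poly_ring V) X"
  from polyomino_ideal_push[OF assms this]
  have "single (seg_monom X m) (1::'k) = 0"
    unfolding push_single .
  then have "lookup (single (seg_monom X m) (1::'k)) (seg_monom X m) = lookup 0 (seg_monom X m)"
    by (rule arg_cong)
  then show False unfolding lookup_single_eq lookup_zero by (rule one_neq_zero[THEN notE])
qed

subsection \<open>Parallelogram polyominoes\<close>

lemma adjacent_cellsD:
  assumes "adjacent_cells (x, y) (x', y')"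
  shows "x' = x \<and> (y' = Suc y \<or> y = Suc y') \<or> y' = y \<and> (x' = Suc x \<or> x = Suc x')"
proof -
  have edges: "cell_edges (a, b) = {{(a, b), (Suc a, b)}, {(a, Suc b), (Suc a, Suc b)},
      {(a, b), (a, Suc b)}, {(Suc a, b), (Suc a, Suc b)}}" for a b
    by (simp add: cell_edges_def lower_left_def lower_right_def upper_left_def upper_right_def)
  \<comment> \<open>Excludes equal cells: they share four vertices, which do not form an
    edge.\<close>
  have "cell_vertices (x, y) \<notin> cell_edges (x, y)"
    by (auto simp: edges cell_vertices_eq insert_eq_iff doubleton_eq_iff)
  then have "(x', y') \<noteq> (x, y)"
    using assms by (auto simp: adjacent_cells_def)
  moreover have "cell_edges (x, y) \<inter> cell_edges (x', y') \<noteq> {}"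
    using assms by (auto simp: adjacent_cells_def)
  ultimately show ?thesis
    by (auto simp: edges doubleton_eq_iff)
qed

text \<open>A discrete intermediate value argument: a connecting path has a first cell outside
  \<open>Z\<close>.\<close>

lemma polyomino_crossing:
  assumes "polyomino P" "C \<in> P" "D \<in> P" "Z C" "\<not> Z D"
  obtains E E' where "E \<in> P" "E' \<in> P" "Z E" "\<not> Z E'" "adjacent_cells E E'"
proof -
  obtain Cs where Cs: "Cs \<noteq> []" "hd Cs = C" "last Cs = D" "set Cs \<subseteq> P"
    "\<And>i. Suc i < length Cs \<Longrightarrow> adjacent_cells (Cs ! i) (Cs ! Suc i)"
    using assms(1-3) unfolding polyomino_def by metis
  define i where "i = (LEAST i. i < length Cs \<and> \<not> Z (Cs ! i))"
  have "length Cs - 1 < length Cs \<and> \<not> Z (Cs ! (length Cs - 1))"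
    using Cs assms(5) by (simp add: last_conv_nth)
  then have i: "i < length Cs" "\<not> Z (Cs ! i)"
    unfolding i_def by (metis (mono_tags, lifting) LeastI)+
  have "i \<noteq> 0"
    using i Cs assms(4) by (metis hd_conv_nth)
  then obtain j where j: "i = Suc j" by (cases i) auto
  have "Z (Cs ! j)"
    using not_less_Least[of j "\<lambda>i. i < length Cs \<and> \<not> Z (Cs ! i)"] i j unfolding i_def by auto
  then show thesis
    using that[of "Cs ! j" "Cs ! i"] i j Cs(4,5) by (metis Suc_lessD nth_mem subsetD)
qed

context
  fixes Q :: "cell set"
  assumes Q: "parallelogram_polyomino Q"
begin

lemma row_convex:
  assumes "(x1, y) \<in> Q" "(x2, y) \<in> Q" "x1 \<le> x" "x \<le> x2"
  shows "(x, y) \<in> Q"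
proof (cases "x1 < x2")
  case True
  have "horizontally_convex Q" using Q by (simp add: parallelogram_polyomino_def)
  with True assms show ?thesis unfolding horizontally_convex_def by blast
next
  case False
  with assms have "x = x1" by linarith
  with assms show ?thesis by simp
qed

lemma column_convex:
  assumes "(x, y1) \<in> Q" "(x, y2) \<in> Q" "y1 \<le> y" "y \<le> y2"
  shows "(x, y) \<in> Q"
proof (cases "y1 < y2")
  case True
  have "vertically_convex Q" using Q by (simp add: parallelogram_polyomino_def)
  with True assms show ?thesis unfolding vertically_convex_def by blast
next
  case False
  with assms have "y = y1" by linarith
  with assms show ?thesis by simp
qed

lemma vertices_inf_sup:
  assumes "(x1, y1) \<in> vertices Q" "(x2, y2) \<in> vertices Q"
  shows "(min x1 x2, min y1 y2) \<in> vertices Q" "(max x1 x2, max y1 y2) \<in> vertices Q"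
proof -
  have "inf (x1, y1) (x2, y2) \<in> vertices Q \<and> sup (x1, y1) (x2, y2) \<in> vertices Q"
    using Q assms unfolding parallelogram_polyomino_def sublattice_def by blast
  then show "(min x1 x2, min y1 y2) \<in> vertices Q" "(max x1 x2, max y1 y2) \<in> vertices Q"
    by (simp_all add: inf_min sup_max)
qed

lemma crossing:
  assumes "(a, b) \<in> Q" "(c, d) \<in> Q" "Z a b" "\<not> Z c d"
  shows "\<exists>x y x' y'. (x, y) \<in> Q \<and> (x', y') \<in> Q \<and> Z x y \<and> \<not> Z x' y' \<and>
    (x' = x \<and> (y' = Suc y \<or> y = Suc y') \<or> y' = y \<and> (x' = Suc x \<or> x = Suc x'))"
proof -
  have "polyomino Q" using Q by (simp add: parallelogram_polyomino_def)
  then obtain E E' where E: "E \<in> Q" "E' \<in> Q" "Z (fst E) (snd E)" "\<not> Z (fst E') (snd E')" "adjacent_cells E E'"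
    by (rule polyomino_crossing[of Q "(a, b)" "(c, d)" "\<lambda>v. Z (fst v) (snd v)"]) (use assms in simp_all)
  then show ?thesis
    using adjacent_cellsD[of "fst E" "snd E" "fst E'" "snd E'"]
    by (metis prod.collapse)
qed

text \<open>
  If row \<open>y\<close> lies entirely to the right of column \<open>x\<close>, and column \<open>x\<close> lies entirely above row \<open>y\<close>,
  then no path leaves the quadrant to the lower left of \<open>(x, y)\<close>.
\<close>

lemma no_cell_lower_left:
  assumes "(x, y) \<notin> Q" "(x, y1) \<in> Q" "y < y1" "(x1, y) \<in> Q" "x < x1" "(a, b) \<in> Q" "a < x" "b < y"
  shows False
proof -
  have "\<exists>u v u' v'. (u, v) \<in> Q \<and> (u', v') \<in> Q \<and> (u < x \<and> v < y) \<and> \<not> (u' < x \<and> v' < y) \<and>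
      (u' = u \<and> (v' = Suc v \<or> v = Suc v') \<or> v' = v \<and> (u' = Suc u \<or> u = Suc u'))"
    by (rule crossing[of a b x1 y "\<lambda>a b. a < x \<and> b < y"]) (use assms in auto)
  then obtain u v u' v' where uv: "(u, v) \<in> Q" "(u', v') \<in> Q" "u < x \<and> v < y" "\<not> (u' < x \<and> v' < y)"
    "u' = u \<and> (v' = Suc v \<or> v = Suc v') \<or> v' = v \<and> (u' = Suc u \<or> u = Suc u')"
    by blast
  then consider "u' = x" "v' < y" | "v' = y" "u' < x" by linarith
  then show False
  proof cases
    case 1
    then show False using column_convex[of x v' y1 y] uv assms by auto
  next
    case 2
    then show False using row_convex[of u' y x1 x] uv assms by auto
  qed
qed

lemma no_cell_upper_right:
  assumes "(x, y) \<notin> Q" "(x, y1) \<in> Q" "y1 < y" "(x1, y) \<in> Q" "x1 < x" "(a, b) \<in> Q" "x < a" "y < b"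
  shows False
proof -
  have "\<exists>u v u' v'. (u, v) \<in> Q \<and> (u', v') \<in> Q \<and> (x < u \<and> y < v) \<and> \<not> (x < u' \<and> y < v') \<and>
      (u' = u \<and> (v' = Suc v \<or> v = Suc v') \<or> v' = v \<and> (u' = Suc u \<or> u = Suc u'))"
    by (rule crossing[of a b x1 y "\<lambda>a b. x < a \<and> y < b"]) (use assms in auto)
  then obtain u v u' v' where uv: "(u, v) \<in> Q" "(u', v') \<in> Q" "x < u \<and> y < v" "\<not> (x < u' \<and> y < v')"
    "u' = u \<and> (v' = Suc v \<or> v = Suc v') \<or> v' = v \<and> (u' = Suc u \<or> u = Suc u')"
    by blast
  then consider "u' = x" "y < v'" | "v' = y" "x < u'" by linarith
  then show False
  proof cases
    case 1
    then show False using column_convex[of x y1 v' y] uv assms by auto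
  next
    case 2
    then show False using row_convex[of x1 y u' x] uv assms by auto
  qed
qed

text \<open>The sublattice property makes \<open>(x, y)\<close> a vertex, so one of the four cells
  around it is in \<open>Q\<close>. For each of the three wrong ones, convexity supplies
  \<open>(x, y)\<close> itself or connectedness is violated.\<close>

lemma cell_meet:
  assumes "(x, Suc y) \<in> Q" "(Suc x, y) \<in> Q"
  shows "(x, y) \<in> Q"
proof (rule ccontr)
  assume n: "(x, y) \<notin> Q"
  have "(x, Suc y) \<in> vertices Q" "(Suc x, y) \<in> vertices Q"
    using assms by (auto simp: mem_vertices_iff)
  then have "(x, y) \<in> vertices Q"
    using vertices_inf_sup(1)[of x "Suc y" "Suc x" y] by simp
  with n consider "0 < x" "(x - 1, y) \<in> Q" | "0 < y" "(x, y - 1) \<in> Q" |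
    "0 < x" "0 < y" "(x - 1, y - 1) \<in> Q"
    by (auto simp: mem_vertices_iff)
  then show False
  proof cases
    case 1
    then show False using row_convex[of "x - 1" y "Suc x" x] assms n by auto
  next
    case 2
    then show False using column_convex[of x "y - 1" "Suc y" y] assms n by auto
  next
    case 3
    then show False using no_cell_lower_left[OF n assms(1) _ assms(2) _ 3(3)] by auto
  qed
qed

lemma cell_join:
  assumes "(x, Suc y) \<in> Q" "(Suc x, y) \<in> Q"
  shows "(Suc x, Suc y) \<in> Q"
proof (rule ccontr)
  assume n: "(Suc x, Suc y) \<notin> Q"
  \<comment> \<open>The upper right vertices of the two cells; their join is the upper right vertex
    of the desired cell.\<close>
  have "(Suc x, Suc (Suc y)) \<in> vertices Q" "(Suc (Suc x), Suc y) \<in> vertices Q"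
    using assms by (auto simp: mem_vertices_iff)
  then have "(Suc (Suc x), Suc (Suc y)) \<in> vertices Q"
    using vertices_inf_sup(2)[of "Suc x" "Suc (Suc y)" "Suc (Suc x)" "Suc y"] by simp
  with n consider "(Suc (Suc x), Suc y) \<in> Q" | "(Suc x, Suc (Suc y)) \<in> Q" |
    "(Suc (Suc x), Suc (Suc y)) \<in> Q"
    by (auto simp: mem_vertices_iff)
  then show False
  proof cases
    case 1
    then show False using row_convex[of x "Suc y" "Suc (Suc x)" "Suc x"] assms n by auto
  next
    case 2
    then show False using column_convex[of "Suc x" y "Suc (Suc y)" "Suc y"] assms n by auto
  next
    case 3
    then show False using no_cell_upper_right[OF n assms(2) _ assms(1) _ 3] by auto
  qed
qed

text \<open>A path from \<open>(a, b)\<close> back to \<open>(x, y)\<close> leaves the open quadrant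
  through column \<open>x\<close> above \<open>y\<close> or through row \<open>y\<close> to the
  right of \<open>x\<close>; convexity then supplies an excluded neighbour.\<close>

lemma no_cell_beyond_top:
  assumes "(x, y) \<in> Q" "(Suc x, y) \<notin> Q" "(x, Suc y) \<notin> Q" "(a, b) \<in> Q" "x < a" "y < b"
  shows False
proof -
  have "\<exists>u v u' v'. (u, v) \<in> Q \<and> (u', v') \<in> Q \<and> (x < u \<and> y < v) \<and> \<not> (x < u' \<and> y < v') \<and>
      (u' = u \<and> (v' = Suc v \<or> v = Suc v') \<or> v' = v \<and> (u' = Suc u \<or> u = Suc u'))"
    by (rule crossing[of a b x y "\<lambda>a b. x < a \<and> y < b"]) (use assms in auto)
  then obtain u v u' v' where uv: "(u, v) \<in> Q" "(u', v') \<in> Q" "x < u \<and> y < v" "\<not> (x < u' \<and> y < v')"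
    "u' = u \<and> (v' = Suc v \<or> v = Suc v') \<or> v' = v \<and> (u' = Suc u \<or> u = Suc u')"
    by blast
  then consider "u' = x" "y < v'" | "v' = y" "x < u'" by linarith
  then show False
  proof cases
    case 1
    then show False using column_convex[of x y v' "Suc y"] uv assms by auto
  next
    case 2
    then show False using row_convex[of x y u' "Suc x"] uv assms by auto
  qed
qed

lemma no_cell_beyond_bottom:
  assumes "(Suc x, Suc y) \<in> Q" "(x, Suc y) \<notin> Q" "(Suc x, y) \<notin> Q" "(a, b) \<in> Q" "a \<le> x" "b \<le> y"
  shows False
proof -
  have "\<exists>u v u' v'. (u, v) \<in> Q \<and> (u', v') \<in> Q \<and> (u \<le> x \<and> v \<le> y) \<and> \<not> (u' \<le> x \<and> v' \<le> y) \<and>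
      (u' = u \<and> (v' = Suc v \<or> v = Suc v') \<or> v' = v \<and> (u' = Suc u \<or> u = Suc u'))"
    by (rule crossing[of a b "Suc x" "Suc y" "\<lambda>a b. a \<le> x \<and> b \<le> y"]) (use assms in auto)
  then obtain u v u' v' where uv: "(u, v) \<in> Q" "(u', v') \<in> Q" "u \<le> x \<and> v \<le> y" "\<not> (u' \<le> x \<and> v' \<le> y)"
    "u' = u \<and> (v' = Suc v \<or> v = Suc v') \<or> v' = v \<and> (u' = Suc u \<or> u = Suc u')"
    by blast
  then consider "u' = Suc x" "v' \<le> y" | "v' = Suc y" "u' \<le> x" by linarith
  then show False
  proof cases
    case 1
    then show False using column_convex[of "Suc x" v' "Suc y" y] uv assms by auto
  next
    case 2
    then show False using row_convex[of u' "Suc y" "Suc x" x] uv assms by auto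
  qed
qed

text \<open>Joining an offending vertex with the upper right vertex of the cell gives a vertex
  properly beyond that corner. Each cell around it would lie in row \<open>y\<close>, in column
  \<open>x\<close> or in the open quadrant, and all three are ruled out.\<close>

lemma vertices_below_top:
  assumes "(x, y) \<in> Q" "(Suc x, y) \<notin> Q" "(x, Suc y) \<notin> Q" "(a, b) \<in> vertices Q"
  shows "a \<le> Suc x \<and> b \<le> Suc y"
proof (rule ccontr)
  have right: "(a, y) \<notin> Q" "(x, b) \<notin> Q" if "x < a" "y < b" for a b
    using row_convex[of x y a "Suc x"] column_convex[of x y b "Suc y"] assms that by auto
  have nocell: "(a, b) \<notin> Q" if "x < a" "y \<le> b" for a b
  proof (cases "y = b")
    case True
    then show ?thesis using right(1)[of a "Suc y"] that by auto
  next
    case False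
    then show ?thesis using no_cell_beyond_top[OF assms(1-3), of a b] that by auto
  qed
  have nocell': "(a, b) \<notin> Q" if "x \<le> a" "y < b" for a b
  proof (cases "x = a")
    case True
    then show ?thesis using right(2)[of "Suc x" b] that by auto
  next
    case False
    then show ?thesis using no_cell_beyond_top[OF assms(1-3), of a b] that by auto
  qed
  assume n: "\<not> (a \<le> Suc x \<and> b \<le> Suc y)"
  have "(Suc x, Suc y) \<in> vertices Q"
    using assms(1) by (auto simp: mem_vertices_iff)
  from vertices_inf_sup(2)[OF assms(4) this]
  obtain A B where AB: "(A, B) \<in> vertices Q" "Suc x \<le> A" "Suc y \<le> B" "Suc x < A \<or> Suc y < B"
    using n that[of "max a (Suc x)" "max b (Suc y)"] by auto
  then have "x < A" "y \<le> B - 1" "x \<le> A - 1" "y < B" "x < A - 1 \<or> y < B - 1"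
    by auto
  then have "(A, B) \<notin> Q" "(A - 1, B) \<notin> Q" "(A, B - 1) \<notin> Q" "(A - 1, B - 1) \<notin> Q"
    using nocell nocell' by auto
  then show False
    using AB(1) unfolding mem_vertices_iff by blast
qed

text \<open>Dual to \<open>vertices_below_top\<close>, with meets in place of joins; the cell is
  \<open>(Suc x, Suc y)\<close>, whose lower left vertex is the least vertex.\<close>

lemma vertices_above_bottom:
  assumes "(Suc x, Suc y) \<in> Q" "(x, Suc y) \<notin> Q" "(Suc x, y) \<notin> Q" "(a, b) \<in> vertices Q"
  shows "Suc x \<le> a \<and> Suc y \<le> b"
proof (rule ccontr)
  have left: "(a, Suc y) \<notin> Q" "(Suc x, b) \<notin> Q" if "a \<le> x" "b \<le> y" for a b
    using row_convex[of a "Suc y" "Suc x" x] column_convex[of "Suc x" b "Suc y" y] assms that by auto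
  have nocell: "(a, b) \<notin> Q" if "a \<le> x" "b \<le> Suc y" for a b
  proof (cases "b = Suc y")
    case True
    then show ?thesis using left(1)[of a y] that by auto
  next
    case False
    then show ?thesis using no_cell_beyond_bottom[OF assms(1-3), of a b] that by auto
  qed
  have nocell': "(a, b) \<notin> Q" if "a \<le> Suc x" "b \<le> y" for a b
  proof (cases "a = Suc x")
    case True
    then show ?thesis using left(2)[of x b] that by auto
  next
    case False
    then show ?thesis using no_cell_beyond_bottom[OF assms(1-3), of a b] that by auto
  qed
  assume n: "\<not> (Suc x \<le> a \<and> Suc y \<le> b)"
  have "(Suc x, Suc y) \<in> vertices Q"
    using assms(1) by (auto simp: mem_vertices_iff)
  from vertices_inf_sup(1)[OF assms(4) this]
  obtain A B where AB: "(A, B) \<in> vertices Q" "A \<le> Suc x" "B \<le> Suc y" "A \<le> x \<or> B \<le> y"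
    using n that[of "min a (Suc x)" "min b (Suc y)"] by auto
  then have "A - 1 \<le> x" "B - 1 \<le> y" by auto
  then have "(A, B) \<notin> Q" "(A - 1, B) \<notin> Q" "(A, B - 1) \<notin> Q" "(A - 1, B - 1) \<notin> Q"
    using AB nocell nocell' by auto
  then show False
    using AB(1) unfolding mem_vertices_iff by blast
qed

end

subsection \<open>Antidiagonal chains\<close>

locale chains =
  fixes P :: "cell set" and Vs :: "point list list"
  assumes partition: "antidiagonal_partition P Vs"
begin

abbreviation len :: "nat \<Rightarrow> nat" where "len k \<equiv> length (Vs ! k)"
definition px :: "nat \<Rightarrow> nat \<Rightarrow> nat" where "px k i = fst (Vs ! k ! i)"
definition py :: "nat \<Rightarrow> nat \<Rightarrow> nat" where "py k i = snd (Vs ! k ! i)"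

lemma nth_chain: "Vs ! k ! i = (px k i, py k i)"
  by (simp add: px_def py_def)

lemma chain_nonempty: "k < length Vs \<Longrightarrow> 0 < len k"
  using partition unfolding antidiagonal_partition_def by (metis length_greater_0_conv nth_mem)

lemma union_chains: "(\<Union>vs\<in>set Vs. set vs) = vertices P"
  using partition unfolding antidiagonal_partition_def by blast

lemma vertex_in_chain: "v \<in> vertices P \<Longrightarrow> \<exists>k<length Vs. v \<in> set (Vs ! k)"
  unfolding union_chains[symmetric] by (metis UN_E in_set_conv_nth)

lemma chain_vertices: "k < length Vs \<Longrightarrow> set (Vs ! k) \<subseteq> vertices P"
  unfolding union_chains[symmetric] by (rule UN_upper) simp

lemma chain_unique:
  assumes "k < length Vs" "l < length Vs" "v \<in> set (Vs ! k)" "v \<in> set (Vs ! l)"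
  shows "k = l"
proof (rule ccontr)
  assume "k \<noteq> l"
  moreover have "\<forall>k l. k < l \<and> l < length Vs \<longrightarrow> set (Vs ! k) \<inter> set (Vs ! l) = {}"
    using partition unfolding antidiagonal_partition_def by blast
  ultimately show False using assms by (metis IntI empty_iff linorder_neqE_nat)
qed

lemma chain_step:
  assumes "k < length Vs" "Suc i < len k"
  shows "(px k i, py k (Suc i)) \<in> P" "px k (Suc i) = Suc (px k i)" "py k i = Suc (py k (Suc i))"
proof -
  have "\<exists>C\<in>P. Vs ! k ! i = upper_left C \<and> Vs ! k ! Suc i = lower_right C"
    using partition assms unfolding antidiagonal_partition_def by (metis nth_mem)
  then show "(px k i, py k (Suc i)) \<in> P" "px k (Suc i) = Suc (px k i)" "py k i = Suc (py k (Suc i))"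
    by (auto simp: px_def py_def upper_left_def lower_right_def)
qed

lemma px_eq: "k < length Vs \<Longrightarrow> i < len k \<Longrightarrow> px k i = px k 0 + i"
  by (induction i) (auto simp: chain_step(2))

lemma py_eq: "k < length Vs \<Longrightarrow> i < len k \<Longrightarrow> py k i + i = py k 0"
proof (induction i)
  case (Suc i)
  then show ?case using chain_step(3)[of k i] by auto
qed simp

lemma px_py_sum: "k < length Vs \<Longrightarrow> i < len k \<Longrightarrow> px k i + py k i = px k 0 + py k 0"
  using px_eq[of k i] py_eq[of k i] by linarith

lemma mem_chain_iff: "v \<in> set (Vs ! k) \<longleftrightarrow> (\<exists>i<len k. v = (px k i, py k i))"
  by (auto simp: in_set_conv_nth nth_chain simp flip: nth_chain)

lemma mem_chain_cells_iff:
  assumes "k < length Vs"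
  shows "C \<in> chain_cells P (Vs ! k) \<longleftrightarrow> (\<exists>i. Suc i < len k \<and> C = (px k i, py k (Suc i)))"
proof
  assume "C \<in> chain_cells P (Vs ! k)"
  then obtain i where "Suc i < len k" "upper_left C = Vs ! k ! i" "lower_right C = Vs ! k ! Suc i"
    by (auto simp: chain_cells_def)
  then show "\<exists>i. Suc i < len k \<and> C = (px k i, py k (Suc i))"
    by (intro exI[of _ i]) (cases C, auto simp: px_def py_def upper_left_def lower_right_def simp flip: \<open>upper_left C = Vs ! k ! i\<close> \<open>lower_right C = Vs ! k ! Suc i\<close>)
next
  assume "\<exists>i. Suc i < len k \<and> C = (px k i, py k (Suc i))"
  then obtain i where i: "Suc i < len k" "C = (px k i, py k (Suc i))" by blast
  then show "C \<in> chain_cells P (Vs ! k)"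
    using chain_step[OF assms i(1)]
    by (auto simp: chain_cells_def upper_left_def lower_right_def nth_chain intro!: exI[of _ i])
qed

lemma chain_order:
  assumes "k < l" "l < length Vs"
  shows "px k 0 + py k 0 \<le> px l 0 + py l 0"
proof -
  have "\<forall>k l. k < l \<and> l < length Vs \<longrightarrow> (let (v1, v2) = hd (Vs ! k); (w1, w2) = hd (Vs ! l)
      in v1 + v2 < w1 + w2 \<or> v1 + v2 = w1 + w2 \<and> v1 < w1)"
    using partition unfolding antidiagonal_partition_def by blast
  then have "let (v1, v2) = hd (Vs ! k); (w1, w2) = hd (Vs ! l)
      in v1 + v2 < w1 + w2 \<or> v1 + v2 = w1 + w2 \<and> v1 < w1"
    using assms by blast
  moreover have "hd (Vs ! k) = (px k 0, py k 0)" "hd (Vs ! l) = (px l 0, py l 0)"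
    using chain_nonempty[of k] chain_nonempty[of l] assms by (simp_all add: hd_conv_nth nth_chain)
  ultimately show ?thesis by auto
qed

text \<open>The upper left vertex of \<open>C\<close> lies on some chain and is not its last
  element, since no chain ends in an upper left vertex; its successor must be the lower right vertex
  of \<open>C\<close>.\<close>

lemma cell_in_chain:
  assumes "C \<in> P"
  shows "\<exists>k<length Vs. C \<in> chain_cells P (Vs ! k)"
proof -
  obtain x y where C: "C = (x, y)" by fastforce
  have "(x, Suc y) \<in> vertices P" using assms C by (auto simp: mem_vertices_iff)
  then obtain k i where k: "k < length Vs" "i < len k" "Vs ! k ! i = (x, Suc y)"
    using vertex_in_chain by (metis in_set_conv_nth)
  have "last (Vs ! k) \<noteq> upper_left C"
    using partition k assms unfolding antidiagonal_partition_def by (metis nth_mem)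
  then have "i \<noteq> len k - 1"
    using k chain_nonempty[of k] by (auto simp: last_conv_nth C upper_left_def)
  then have i: "Suc i < len k" using k by simp
  have "C = (px k i, py k (Suc i))"
    using chain_step(3)[OF k(1) i] k(3) by (simp add: C nth_chain)
  then show ?thesis using k i mem_chain_cells_iff by blast
qed

lemma chain_cell_sum:
  assumes "k < length Vs" "(x, y) \<in> chain_cells P (Vs ! k)"
  shows "Suc (x + y) = px k 0 + py k 0"
proof -
  obtain i where i: "Suc i < len k" "x = px k i" "y = py k (Suc i)"
    using assms by (auto simp: mem_chain_cells_iff)
  then show ?thesis
    using px_py_sum[of k i] chain_step(3)[of k i] assms by auto
qed

lemma chain_sum:
  assumes "k < length Vs" "(x, y) \<in> set (Vs ! k)"
  shows "x + y = px k 0 + py k 0"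
  using assms px_py_sum by (auto simp: mem_chain_iff)

lemma chain_cell_corners:
  assumes "k < length Vs" "(x, y) \<in> chain_cells P (Vs ! k)"
  shows "(x, Suc y) \<in> set (Vs ! k)" "(Suc x, y) \<in> set (Vs ! k)"
proof -
  obtain i where i: "Suc i < len k" "x = px k i" "y = py k (Suc i)"
    using assms by (auto simp: mem_chain_cells_iff)
  show "(x, Suc y) \<in> set (Vs ! k)" "(Suc x, y) \<in> set (Vs ! k)"
    using i chain_step[OF assms(1) i(1)] unfolding mem_chain_iff
    by (auto intro: exI[of _ i] exI[of _ "Suc i"])
qed

end

text \<open>
  The only failure of local closedness in \<open>Q - Q'\<close> happens at an extreme corner of \<open>Q'\<close>, and the
  two cells involved belong to the chain through that corner, which has index \<open>b\<close> (or \<open>a\<close>).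
\<close>

lemma loc_closed_lower:
  assumes Q: "parallelogram_polyomino Q" and Q': "parallelogram_polyomino Q'"
    and P: "P = Q - Q'" and part: "antidiagonal_partition P Vs"
    and b: "b = Max {i. i < length Vs \<and> set (Vs ! i) \<inter> vertices Q' \<noteq> {}}"
  shows "loc_closed True (\<Union>i\<in>{i. i < length Vs \<and> i < b}. chain_cells P (Vs ! i))" (is "loc_closed _ ?R")
  unfolding loc_closed_def if_True
proof (intro allI impI, elim conjE)
  interpret chains P Vs by unfold_locales (rule part)
  fix x y assume "(x, Suc y) \<in> ?R" "(Suc x, y) \<in> ?R"
  then obtain i j where i: "i < length Vs" "i < b" "(x, Suc y) \<in> chain_cells P (Vs ! i)"
    and j: "j < length Vs" "j < b" "(Suc x, y) \<in> chain_cells P (Vs ! j)" by auto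
  then have inP: "(x, Suc y) \<in> P" "(Suc x, y) \<in> P" by (auto simp: chain_cells_def)
  then have "(x, y) \<in> Q" using cell_meet[OF Q] P by auto
  moreover have "(x, y) \<notin> Q'"
  proof
    assume xy: "(x, y) \<in> Q'"
    let ?B = "{i. i < length Vs \<and> set (Vs ! i) \<inter> vertices Q' \<noteq> {}}"
    have t: "(Suc x, Suc y) \<in> set (Vs ! i)"
      using chain_cell_corners(2)[OF i(1,3)] .
    have "(Suc x, Suc y) \<in> vertices Q'" using xy by (auto simp: mem_vertices_iff)
    with t i have iB: "i \<in> ?B" by auto
    have "b \<in> ?B" unfolding b using iB by (intro Max_in) auto
    then obtain u v where uv: "b < length Vs" "(u, v) \<in> set (Vs ! b)" "(u, v) \<in> vertices Q'" by auto
    \<comment> \<open>The corner on chain \<open>i\<close> is the greatest vertex of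
      \<open>Q'\<close>, while a vertex of \<open>Q'\<close> on the later chain \<open>b\<close> has
      at least the same coordinate sum; so the two coincide and \<open>i = b\<close>.\<close>
    have "u \<le> Suc x \<and> v \<le> Suc y"
      using vertices_below_top[OF Q' xy _ _ uv(3)] inP P by auto
    moreover have "Suc x + Suc y \<le> u + v"
      using chain_order[OF i(2) uv(1)] chain_sum[OF i(1) t] chain_sum[OF uv(1,2)] by simp
    ultimately have "u = Suc x" "v = Suc y" by linarith+
    then have "i = b" using chain_unique[OF i(1) uv(1) t] uv by simp
    with i show False by simp
  qed
  ultimately have "(x, y) \<in> P" using P by auto
  then obtain l where l: "l < length Vs" "(x, y) \<in> chain_cells P (Vs ! l)"
    using cell_in_chain by blast
  \<comment> \<open>A cell of smaller level lies on an earlier chain, so its index stays below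
    \<open>b\<close>.\<close>
  have "\<not> i \<le> l"
  proof
    assume "i \<le> l"
    then have "px i 0 + py i 0 \<le> px l 0 + py l 0"
      using chain_order[of i l] l by (cases "i = l") auto
    then show False using chain_cell_sum[OF l] chain_cell_sum[OF i(1,3)] by simp
  qed
  then show "(x, y) \<in> ?R" using l i by (intro UN_I[of l]) auto
qed

lemma loc_closed_upper:
  assumes Q: "parallelogram_polyomino Q" and Q': "parallelogram_polyomino Q'"
    and P: "P = Q - Q'" and part: "antidiagonal_partition P Vs"
    and a: "a = Min {i. i < length Vs \<and> set (Vs ! i) \<inter> vertices Q' \<noteq> {}}"
  shows "loc_closed False (\<Union>i\<in>{i. i < length Vs \<and> a < i}. chain_cells P (Vs ! i))" (is "loc_closed _ ?R")
  unfolding loc_closed_def if_False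
proof (intro allI impI, elim conjE)
  interpret chains P Vs by unfold_locales (rule part)
  fix x y assume "(x, Suc y) \<in> ?R" "(Suc x, y) \<in> ?R"
  then obtain i j where i: "i < length Vs" "a < i" "(x, Suc y) \<in> chain_cells P (Vs ! i)"
    and j: "j < length Vs" "a < j" "(Suc x, y) \<in> chain_cells P (Vs ! j)" by auto
  then have inP: "(x, Suc y) \<in> P" "(Suc x, y) \<in> P" by (auto simp: chain_cells_def)
  then have "(Suc x, Suc y) \<in> Q" using cell_join[OF Q] P by auto
  moreover have "(Suc x, Suc y) \<notin> Q'"
  proof
    assume xy: "(Suc x, Suc y) \<in> Q'"
    let ?B = "{i. i < length Vs \<and> set (Vs ! i) \<inter> vertices Q' \<noteq> {}}"
    have t: "(Suc x, Suc y) \<in> set (Vs ! i)"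
      using chain_cell_corners(2)[OF i(1,3)] .
    have "(Suc x, Suc y) \<in> vertices Q'" using xy by (auto simp: mem_vertices_iff)
    with t i have iB: "i \<in> ?B" by auto
    have "a \<in> ?B" unfolding a using iB by (intro Min_in) auto
    then obtain u v where uv: "a < length Vs" "(u, v) \<in> set (Vs ! a)" "(u, v) \<in> vertices Q'" by auto
    have "Suc x \<le> u \<and> Suc y \<le> v"
      using vertices_above_bottom[OF Q' xy _ _ uv(3)] inP P by auto
    moreover have "u + v \<le> Suc x + Suc y"
      using chain_order[OF i(2,1)] chain_sum[OF i(1) t] chain_sum[OF uv(1,2)] by simp
    ultimately have "u = Suc x" "v = Suc y" by linarith+
    then have "i = a" using chain_unique[OF i(1) uv(1) t] uv by simp
    with i show False by simp
  qed
  ultimately have "(Suc x, Suc y) \<in> P" using P by auto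
  then obtain l where l: "l < length Vs" "(Suc x, Suc y) \<in> chain_cells P (Vs ! l)"
    using cell_in_chain by blast
  have "\<not> l \<le> i"
  proof
    assume "l \<le> i"
    then have "px l 0 + py l 0 \<le> px i 0 + py i 0"
      using chain_order[of l i] i by (cases "i = l") auto
    then show False using chain_cell_sum[OF l] chain_cell_sum[OF i(1,3)] by simp
  qed
  then show "(Suc x, Suc y) \<in> ?R" using l i by (intro UN_I[of l]) auto
qed

subsection \<open>Determinants modulo an ideal\<close>

lemma det_carrier:
  assumes A: "A \<in> carrier_mat n n"
    and carr: "\<And>i j. i < n \<Longrightarrow> j < n \<Longrightarrow> A $$ (i, j) \<in> carrier (poly_ring V)"
  shows "det A \<in> carrier (poly_ring V)"
proof -
  have "signof p \<in> carrier (poly_ring V)" for p :: "nat \<Rightarrow> nat"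
    by (auto simp: sign_def carrier_uminus)
  moreover have "p i < n" if "p permutes {0..<n}" "i < n" for p i
    using permutes_in_image[OF that(1), of i] that(2) by auto
  ultimately show ?thesis
    unfolding det_def'[OF A] using carr by (auto intro!: carrier_sum carrier_mult carrier_prod)
qed

text \<open>Scale row 0 by the pivot \<open>A $$ (1, 1)\<close> and subtract
  \<open>A $$ (0, 1)\<close> times row 1: the entry in column 1 becomes 0 and the later ones fall
  into \<open>I\<close>, so only the first term of the Laplace expansion survives modulo
  \<open>I\<close>.\<close>

lemma (in poly_ideal) det_elim_mem:
  assumes A: "A \<in> carrier_mat n n" and n: "2 \<le> n"
    and carr: "\<And>i j. i < n \<Longrightarrow> j < n \<Longrightarrow> A $$ (i, j) \<in> carrier (poly_ring V)"
    and rel: "\<And>j. 2 \<le> j \<Longrightarrow> j < n \<Longrightarrow> A $$ (0, j) * A $$ (1, 1) - A $$ (0, 1) * A $$ (1, j) \<in> I"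
  shows "A $$ (1, 1) * det A -
    (A $$ (0, 0) * A $$ (1, 1) - A $$ (0, 1) * A $$ (1, 0)) * det (mat_delete A 0 0) \<in> I"
proof -
  define B where "B = addrow (- (A $$ (0, 1))) 0 1 (multrow 0 (A $$ (1, 1)) A)"
  have B: "B \<in> carrier_mat n n" using A by (simp add: B_def)
  have B0: "B $$ (0, j) = A $$ (0, j) * A $$ (1, 1) - A $$ (0, 1) * A $$ (1, j)" if "j < n" for j
    using A n that by (simp add: B_def algebra_simps)
  have "mat_delete B 0 j = mat_delete A 0 j" for j
    using A by (intro eq_matI) (auto simp: mat_delete_def B_def)
  then have cof: "cofactor B 0 j = cofactor A 0 j" for j
    by (simp add: cofactor_def)
  have "det (addrow (- (A $$ (0, 1))) 0 1 (multrow 0 (A $$ (1, 1)) A)) = det (multrow 0 (A $$ (1, 1)) A)"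
    using A n by (intro det_addrow) auto
  also have "\<dots> = A $$ (1, 1) * det A"
    using A n by (intro det_multrow) auto
  finally have "A $$ (1, 1) * det A = det B" by (simp only: B_def)
  also have "\<dots> = (\<Sum>j<n. B $$ (0, j) * cofactor A 0 j)"
    using laplace_expansion_row[OF B, of 0] n by (simp add: cof)
  also have "\<dots> = B $$ (0, 0) * cofactor A 0 0 + (\<Sum>j\<in>{1..<n}. B $$ (0, j) * cofactor A 0 j)"
    using n by (simp add: lessThan_atLeast0 sum.atLeast_Suc_lessThan)
  also have "B $$ (0, 0) * cofactor A 0 0 =
      (A $$ (0, 0) * A $$ (1, 1) - A $$ (0, 1) * A $$ (1, 0)) * det (mat_delete A 0 0)"
    using n by (simp add: B0 cofactor_def)
  finally have eq: "A $$ (1, 1) * det A -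
      (A $$ (0, 0) * A $$ (1, 1) - A $$ (0, 1) * A $$ (1, 0)) * det (mat_delete A 0 0) =
      (\<Sum>j\<in>{1..<n}. B $$ (0, j) * cofactor A 0 j)"
    by simp
  have "B $$ (0, j) * cofactor A 0 j \<in> I" if j: "j \<in> {1..<n}" for j
  proof -
    have "B $$ (0, j) \<in> I"
    proof (cases "j = 1")
      case True
      then show ?thesis using j by (simp add: B0 mult.commute)
    next
      case False
      then show ?thesis using j rel[of j] by (simp add: B0)
    qed
    moreover have "cofactor A 0 j \<in> carrier (poly_ring V)"
    proof -
      have M: "mat_delete A 0 j \<in> carrier_mat (n - 1) (n - 1)"
        using A by (rule mat_delete_carrier)
      then have "det (mat_delete A 0 j) \<in> carrier (poly_ring V)"
        using A j by (intro det_carrier[OF mat_delete_carrier[OF A]]) (auto simp: mat_delete_def intro!: carr)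
      moreover have "((- 1) ^ j :: ('v, 'k) mpoly) \<in> carrier (poly_ring V)"
        by (induction j) (auto intro!: carrier_mult carrier_uminus)
      ultimately show ?thesis by (simp add: cofactor_def carrier_mult)
    qed
    ultimately show ?thesis
      using mult_mem by (simp add: mult.commute)
  qed
  then show ?thesis unfolding eq by (rule sum_mem)
qed

text \<open>
  Modulo relations making the upper triangle of rank one, the rows can be eliminated one at a
  time, and the determinant factors into the \<open>2\<close>-minors along the diagonal.
\<close>

lemma (in poly_ideal) det_chain_mem:
  fixes M :: "nat \<Rightarrow> nat \<Rightarrow> ('v, 'k) mpoly"
  assumes n: "0 < n"
    and carr: "\<And>i j. i < n \<Longrightarrow> j < n \<Longrightarrow> M i j \<in> carrier (poly_ring V)"
    and rel: "\<And>i j. Suc i < j \<Longrightarrow> j < n \<Longrightarrow> M i j * M (Suc i) (Suc i) - M i (Suc i) * M (Suc i) j \<in> I"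
  shows "(\<Prod>i\<in>{1..<n}. M i i) * det (mat n n (\<lambda>(i, j). M i j)) -
    (\<Prod>i<n - 1. M i i * M (Suc i) (Suc i) - M i (Suc i) * M (Suc i) i) * M (n - 1) (n - 1) \<in> I"
proof -
  define D where "D k = det (mat (n - k) (n - k) (\<lambda>(i, j). M (i + k) (j + k)))" for k
  define g where "g i = M i i * M (Suc i) (Suc i) - M i (Suc i) * M (Suc i) i" for i
  have g: "g i \<in> carrier (poly_ring V)" if "Suc i < n" for i
    using that unfolding g_def by (intro carrier_intros carr) auto
  have step: "M (Suc k) (Suc k) * D k - g k * D (Suc k) \<in> I" if k: "Suc k < n" for k
  proof -
    let ?A = "mat (n - k) (n - k) (\<lambda>(i, j). M (i + k) (j + k))"
    have "mat_delete ?A 0 0 = mat (n - Suc k) (n - Suc k) (\<lambda>(i, j). M (i + Suc k) (j + Suc k))"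
      by (intro eq_matI) (auto simp: mat_delete_def)
    then have del: "det (mat_delete ?A 0 0) = D (Suc k)" by (simp add: D_def)
    have "?A $$ (1, 1) * det ?A -
        (?A $$ (0, 0) * ?A $$ (1, 1) - ?A $$ (0, 1) * ?A $$ (1, 0)) * det (mat_delete ?A 0 0) \<in> I"
    proof (rule det_elim_mem)
      fix j assume "2 \<le> j" "j < n - k"
      then show "?A $$ (0, j) * ?A $$ (1, 1) - ?A $$ (0, 1) * ?A $$ (1, j) \<in> I"
        using rel[of k "j + k"] by simp
    qed (use k in \<open>auto intro!: carr\<close>)
    then show ?thesis using k unfolding del by (simp add: g_def D_def)
  qed
  \<comment> \<open>Downward induction over the trailing blocks \<open>D k\<close>. The last block
    is the single entry \<open>M (n - 1) (n - 1)\<close>, which accounts for the extra factor on the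
    right.\<close>
  have "(\<Prod>i\<in>{Suc k..<n}. M i i) * D k - (\<Prod>i\<in>{k..<n - 1}. g i) * M (n - 1) (n - 1) \<in> I" if "k < n" for k
    using that
  proof (induction "n - 1 - k" arbitrary: k)
    case 0
    then have k: "k = n - 1" using n by auto
    have "D k = M (n - 1) (n - 1)"
      unfolding D_def k using n by (subst det_single) auto
    then show ?case using k n by simp
  next
    case (Suc d)
    then have k: "Suc k < n" by auto
    let ?p = "\<Prod>i\<in>{Suc (Suc k)..<n}. M i i"
    have "?p * (M (Suc k) (Suc k) * D k - g k * D (Suc k)) \<in> I"
      using step[OF k] by (intro mult_mem carrier_prod carr) auto
    moreover have "g k * (?p * D (Suc k) - (\<Prod>i\<in>{Suc k..<n - 1}. g i) * M (n - 1) (n - 1)) \<in> I"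
      using Suc k by (intro mult_mem g) auto
    ultimately have "?p * (M (Suc k) (Suc k) * D k - g k * D (Suc k)) +
        g k * (?p * D (Suc k) - (\<Prod>i\<in>{Suc k..<n - 1}. g i) * M (n - 1) (n - 1)) \<in> I"
      by (rule add_mem)
    moreover have "(\<Prod>i\<in>{Suc k..<n}. M i i) = M (Suc k) (Suc k) * ?p"
      "(\<Prod>i\<in>{k..<n - 1}. g i) = g k * (\<Prod>i\<in>{Suc k..<n - 1}. g i)"
      using k by (auto simp: prod.atLeast_Suc_lessThan)
    ultimately show ?case by (simp add: algebra_simps)
  qed
  from this[of 0] n show ?thesis
    by (simp add: D_def g_def lessThan_atLeast0)
qed

subsection \<open>A monomial order for which antidiagonal terms lead\<close>

text \<open>The summand 1 gives every indeterminate positive weight, so that 1 is the only monomial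
  of weight 0. It contributes equally to all terms of one determinant.\<close>

definition vweight :: "point \<Rightarrow> nat" where
  "vweight v = nat ((int (fst v) - int (snd v))\<^sup>2) + 1"

definition weight :: "point monom \<Rightarrow> nat" where
  "weight m = (\<Sum>v\<in>keys m. lookup m v * vweight v)"

lemma weight_superset: "finite A \<Longrightarrow> keys m \<subseteq> A \<Longrightarrow> weight m = (\<Sum>v\<in>A. lookup m v * vweight v)"
  unfolding weight_def by (rule sum.mono_neutral_left) (auto simp: in_keys_iff)

lemma weight_add: "weight (m + n) = weight m + weight n"
  by (subst (1 2 3) weight_superset[of "keys m \<union> keys n"])
    (auto simp: keys_add_nat lookup_add algebra_simps sum.distrib)

lemma weight_zero [simp]: "weight 0 = 0"
  by (simp add: weight_def)

lemma weight_single [simp]: "weight (single v (Suc 0)) = vweight v"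
  by (simp add: weight_def)

lemma weight_sum: "weight (\<Sum>i\<in>A. m i) = (\<Sum>i\<in>A. weight (m i))"
  by (induction A rule: infinite_finite_induct) (simp_all add: weight_add)

lemma weight_eq_0_iff [simp]: "weight m = 0 \<longleftrightarrow> m = 0"
proof
  assume m: "weight m = 0"
  show "m = 0"
  proof (rule poly_mapping_eqI)
    fix v
    show "lookup m v = lookup 0 v"
    proof (cases "v \<in> keys m")
      case True
      then have "lookup m v * vweight v = 0"
        using m unfolding weight_def by simp
      then show ?thesis by (simp add: vweight_def)
    qed (simp add: in_keys_iff)
  qed
qed simp

text \<open>Exponent vectors over \<open>nat\<close> are linearly ordered compatibly with addition;
  injectivity of \<open>prod_encode\<close> transports this order to the points, where it separates
  monomials of equal weight.\<close>

definition tiebreak :: "point monom \<Rightarrow> nat monom" where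
  "tiebreak m = push prod_encode m"

lemma tiebreak_add: "tiebreak (m + n) = tiebreak m + tiebreak n"
  by (simp add: tiebreak_def push_add)

lemma tiebreak_inj: "tiebreak m = tiebreak n \<Longrightarrow> m = n"
  unfolding tiebreak_def by (rule push_inj[OF inj_prod_encode])

definition weight_order :: "point set \<Rightarrow> point monom rel" where
  "weight_order V = {(m, n). m \<in> monoms V \<and> n \<in> monoms V \<and>
     (weight m < weight n \<or> weight m = weight n \<and> tiebreak m \<le> tiebreak n)}"

lemma monomial_order_weight_order: "monomial_order V (weight_order V)"
  unfolding monomial_order_def
proof (intro conjI ballI allI impI)
  have "antisym (weight_order V)"
    by (rule antisymI) (auto simp: weight_order_def dest: tiebreak_inj order_antisym)
  moreover have "trans (weight_order V)"
    by (rule transI) (auto simp: weight_order_def)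
  ultimately show "linear_order_on (monoms V) (weight_order V)"
    unfolding order_on_defs by (auto simp: weight_order_def refl_on_def total_on_def)
next
  fix m assume "m \<in> monoms V"
  moreover have "weight 0 < weight m \<or> m = 0"
    by (metis weight_eq_0_iff weight_zero gr0I)
  ultimately show "(0, m) \<in> weight_order V"
    by (auto simp: weight_order_def)
next
  fix m n t assume "(m, n) \<in> weight_order V \<and> t \<in> monoms V"
  then show "(m + t, n + t) \<in> weight_order V"
    by (auto simp: weight_order_def weight_add tiebreak_add intro: add_right_mono)
qed

text \<open>Dominance is demanded in weight alone, before any tie-breaking, and with coefficient 1;
  in this form it passes to products by adding weights.\<close>

definition leads :: "point monom \<Rightarrow> (point, 'k::field) mpoly \<Rightarrow> bool" where
  "leads m p \<longleftrightarrow> lookup p m = 1 \<and> (\<forall>n\<in>keys p. n \<noteq> m \<longrightarrow> weight n < weight m)"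

lemma leads_mon [simp]: "leads m (mon m)"
  by (auto simp: leads_def)

lemma leadsE:
  assumes "leads m p"
  obtains q where "p = mon m + q" "\<And>n. n \<in> keys q \<Longrightarrow> weight n < weight m"
proof
  show "p = mon m + (p - mon m)" by simp
  fix n assume "n \<in> keys (p - mon m)"
  then show "weight n < weight m"
    using assms by (cases "n = m") (auto simp: leads_def in_keys_iff lookup_minus lookup_single)
qed

lemma leadsI:
  assumes "p = mon m + q" "\<And>n. n \<in> keys q \<Longrightarrow> weight n < weight m"
  shows "leads m p"
proof -
  have "m \<notin> keys q" using assms(2) by blast
  then show ?thesis
    using assms by (auto simp: leads_def lookup_add in_keys_iff lookup_single when_def)
qed

lemma leads_mult:
  assumes "leads m p" "leads n q"
  shows "leads (m + n) (p * q)"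
proof -
  obtain p' where p': "p = mon m + p'" "\<And>n. n \<in> keys p' \<Longrightarrow> weight n < weight m"
    using assms(1) by (rule leadsE) blast
  obtain q' where q': "q = mon n + q'" "\<And>m. m \<in> keys q' \<Longrightarrow> weight m < weight n"
    using assms(2) by (rule leadsE) blast
  show ?thesis
  proof (rule leadsI)
    show "p * q = mon (m + n) + (mon m * q' + p' * mon n + p' * q')"
      by (simp add: p' q' algebra_simps mult_single)
    fix t assume "t \<in> keys (mon m * q' + p' * mon n + p' * q')"
    then have "t \<in> keys (mon m * q') \<union> keys (p' * mon n) \<union> keys (p' * q')"
      using keys_add[of "mon m * q' + p' * mon n" "p' * q'"] keys_add[of "mon m * q'" "p' * mon n"] by blast
    then show "weight t < weight (m + n)"
      using keys_mult[of "mon m" q'] keys_mult[of p' "mon n"] keys_mult[of p' q'] p'(2) q'(2)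
      by (fastforce simp: weight_add)
  qed
qed

lemma leads_prod:
  assumes "\<And>i. i \<in> A \<Longrightarrow> leads (m i) (p i)"
  shows "leads (\<Sum>i\<in>A. m i) (\<Prod>i\<in>A. p i)"
  using assms
  by (induction A rule: infinite_finite_induct) (auto intro: leads_mult simp flip: single_one)

lemma leads_nonzero: "leads m p \<Longrightarrow> p \<noteq> 0"
  by (auto simp: leads_def)

lemma initial_monom_eq:
  assumes "leads m p" "p \<in> carrier (poly_ring V)"
  shows "initial_monom (weight_order V) p = m"
  unfolding initial_monom_def
proof (rule the_equality)
  have keys: "keys p \<subseteq> monoms V" using assms(2) by (simp add: carrier_poly_ring)
  have m: "m \<in> keys p" using assms(1) by (simp add: leads_def in_keys_iff)
  have le: "n \<in> keys p \<Longrightarrow> n \<noteq> m \<Longrightarrow> weight n < weight m" for n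
    using assms(1) by (auto simp: leads_def)
  show "m \<in> keys p \<and> (\<forall>n\<in>keys p. (n, m) \<in> weight_order V)"
    using m keys le by (fastforce simp: weight_order_def)
  fix n assume n: "n \<in> keys p \<and> (\<forall>n'\<in>keys p. (n', n) \<in> weight_order V)"
  then have "(m, n) \<in> weight_order V" using m by blast
  then have "\<not> weight n < weight m" by (auto simp: weight_order_def)
  then show "n = m" using le n by blast
qed

text \<open>
  With \<open>c = x - y\<close>, the difference of the weights of the identity and of \<open>\<sigma>\<close> is
  \<open>\<Sum>i. (i - \<sigma> i)\<^sup>2\<close>.
\<close>

lemma antidiagonal_weight_less:
  fixes n :: nat
  assumes p: "p permutes {0..<n}" "p \<noteq> id"
    and x: "\<And>i. i < n \<Longrightarrow> x i = x0 + i" and y: "\<And>i. i < n \<Longrightarrow> y i + i = (y0::nat)"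
  shows "(\<Sum>i=0..<n. vweight (x i, y (p i))) < (\<Sum>i=0..<n. vweight (x i, y i))"
proof -
  define c :: int where "c = int x0 - int y0"
  have pn: "p i < n" if "i < n" for i
    using permutes_in_image[OF p(1), of i] that by auto
  have w: "int (vweight (x i, y j)) = (c + int i + int j)\<^sup>2 + 1" if "i < n" "j < n" for i j
  proof -
    have "int (x i) - int (y j) = c + int i + int j"
      using x[OF that(1)] y[OF that(2)] by (simp add: c_def)
    then show ?thesis by (simp add: vweight_def)
  qed
  have s1: "(\<Sum>i=0..<n. int (p i)) = (\<Sum>i=0..<n. int i)"
    using sum.permute[OF p(1), of int] by (simp add: o_def)
  have s2: "(\<Sum>i=0..<n. (int (p i))\<^sup>2) = (\<Sum>i=0..<n. (int i)\<^sup>2)"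
    using sum.permute[OF p(1), of "\<lambda>i. (int i)\<^sup>2"] by (simp add: o_def)
  have "int (\<Sum>i=0..<n. vweight (x i, y i)) - int (\<Sum>i=0..<n. vweight (x i, y (p i)))
      = (\<Sum>i=0..<n. (c + int i + int i)\<^sup>2 - (c + int i + int (p i))\<^sup>2)"
    using pn by (simp add: w sum_subtractf sum.distrib)
  \<comment> \<open>The last two terms cancel on summation, because \<open>p\<close> permutes the
    indices; the squares remain.\<close>
  also have "\<dots> = (\<Sum>i=0..<n. (int i - int (p i))\<^sup>2 + 2 * c * (int i - int (p i)) + 2 * ((int i)\<^sup>2 - (int (p i))\<^sup>2))"
    by (intro sum.cong) (auto simp: power2_eq_square algebra_simps)
  also have "\<dots> = (\<Sum>i=0..<n. (int i - int (p i))\<^sup>2) + 2 * c * (\<Sum>i=0..<n. int i - int (p i)) +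
      2 * (\<Sum>i=0..<n. (int i)\<^sup>2 - (int (p i))\<^sup>2)"
    by (simp add: sum.distrib sum_distrib_left)
  also have "\<dots> = (\<Sum>i=0..<n. (int i - int (p i))\<^sup>2)"
    using s1 s2 by (simp add: sum_subtractf)
  also have "\<dots> > 0"
  proof -
    obtain i where i: "p i \<noteq> i" using p(2) by (auto simp: fun_eq_iff)
    then have "i \<in> {0..<n}" using p(1) by (auto simp: permutes_def)
    then show ?thesis
      using i by (intro sum_pos2[of _ i]) auto
  qed
  finally show ?thesis by linarith
qed

lemma prod_indet:
  "finite A \<Longrightarrow> (\<Prod>i\<in>A. indet (f i)) = (mon (\<Sum>i\<in>A. single (f i) 1) :: ('v, 'k::field) mpoly)"
  by (induction A rule: finite_induct) (simp_all add: indet_def mult_single)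

text \<open>The matrix diagonal runs along the chain, an antidiagonal of the plane. Zero entries can
  only delete terms of other permutations, all of which are lighter.\<close>

lemma leads_det:
  fixes M :: "nat \<Rightarrow> nat \<Rightarrow> (point, 'k::field) mpoly"
  assumes x: "\<And>i. i < n \<Longrightarrow> x i = x0 + i" and y: "\<And>i. i < n \<Longrightarrow> y i + i = y0"
    and M: "\<And>i j. i < n \<Longrightarrow> j < n \<Longrightarrow> M i j = indet (x i, y j) \<or> M i j = 0"
    and diag: "\<And>i. i < n \<Longrightarrow> M i i = indet (x i, y i)"
  shows "leads (\<Sum>i<n. single (x i, y i) 1) (det (mat n n (\<lambda>(i, j). M i j)))"
proof -
  let ?S = "{p. p permutes {0..<n}}" and ?m = "\<lambda>p. \<Sum>i=0..<n. single (x i, y (p i)) 1 :: point monom"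
  let ?t = "\<lambda>p. signof p * (\<Prod>i=0..<n. M i (p i))"
  have pn: "p i < n" if "p \<in> ?S" "i < n" for p i
    using permutes_in_image[of p "{0..<n}" i] that by auto
  have "det (mat n n (\<lambda>(i, j). M i j)) = (\<Sum>p\<in>?S. ?t p)"
    unfolding det_def'[OF mat_carrier] using pn by (intro sum.cong arg_cong2[of _ _ _ _ "(*)"] prod.cong) auto
  also have "\<dots> = ?t id + (\<Sum>p\<in>?S - {id}. ?t p)"
    by (rule sum.remove) (auto simp: finite_permutations permutes_id)
  also have "?t id = mon (?m id)"
    using prod_indet[of "{0..<n}" "\<lambda>i. (x i, y i)"] by (simp add: diag)
  finally have eq: "det (mat n n (\<lambda>(i, j). M i j)) = mon (?m id) + (\<Sum>p\<in>?S - {id}. ?t p)" .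
  have keys_t: "keys (?t p) \<subseteq> {?m p}" if "p \<in> ?S" for p
  proof (cases "\<exists>i<n. M i (p i) = 0")
    case True
    then have "(\<Prod>i=0..<n. M i (p i)) = 0" by (intro prod_zero) auto
    then show ?thesis by simp
  next
    case False
    then have "(\<Prod>i=0..<n. M i (p i)) = (\<Prod>i=0..<n. indet (x i, y (p i)))"
      using M pn[OF that] by (intro prod.cong) force+
    then have "?t p = single (?m p) 1 \<or> ?t p = - single (?m p) 1"
      by (auto simp: prod_indet sign_def)
    then show ?thesis by (auto simp flip: single_uminus)
  qed
  have "leads (?m id) (det (mat n n (\<lambda>(i, j). M i j)))"
  proof (rule leadsI[OF eq])
    fix t assume "t \<in> keys (\<Sum>p\<in>?S - {id}. ?t p)"
    then obtain p where p: "p \<in> ?S" "p \<noteq> id" "t \<in> keys (?t p)"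
      using keys_sum[of ?t "?S - {id}"] by blast
    then have "t = ?m p" using keys_t by blast
    then show "weight t < weight (?m id)"
      using antidiagonal_weight_less[of p n x x0 y y0] p x y by (simp add: weight_sum)
  qed
  then show ?thesis by (simp add: lessThan_atLeast0)
qed

subsection \<open>Knutson ideals\<close>

text \<open>Points are only partially ordered, so the argument is transported by the injective
  renaming \<open>prod_encode\<close> to indeterminates indexed by \<open>nat\<close>.\<close>

lemma mult_eq_0_point:
  fixes p q :: "(point, 'k::field) mpoly"
  assumes "p * q = 0"
  shows "p = 0 \<or> q = 0"
proof -
  have inj: "inj (push prod_encode :: point monom \<Rightarrow> nat monom)"
    by (rule injI) (rule push_inj[OF inj_prod_encode])
  have "push (push prod_encode :: point monom \<Rightarrow> nat monom) p * push (push prod_encode) q = 0"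
    using assms by (simp add: push_add flip: push_mult)
  then show ?thesis
    using push_inj[OF inj, of _ 0] by auto
qed

lemma Idl_single:
  assumes "f \<in> carrier (poly_ring V)"
  shows "Idl\<^bsub>poly_ring V\<^esub> {f} = {p * f | p. p \<in> carrier (poly_ring V)}"
  using cring.cgenideal_eq_genideal[OF cring_poly_ring assms] by (auto simp: cgenideal_def)

lemma ideal_Idl_single: "f \<in> carrier (poly_ring V) \<Longrightarrow> ideal (Idl\<^bsub>poly_ring V\<^esub> {f}) (poly_ring V)"
  by (intro ring.genideal_ideal cring.axioms(1) cring_poly_ring) simp

lemma set_add_poly_ring: "A <+>\<^bsub>poly_ring V\<^esub> B = {p + q | p q. p \<in> A \<and> q \<in> B}"
  by (auto simp: set_add_def')

text \<open>In a domain, (F g) : (g) = (F) for nonzero g.\<close>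

lemma Idl_factor_in_knutson_class:
  fixes F g :: "(point, 'k::field) mpoly"
  assumes F: "F \<in> carrier (poly_ring V)" and g: "g \<in> carrier (poly_ring V)" "g \<noteq> 0"
  shows "Idl\<^bsub>poly_ring V\<^esub> {F} \<in> knutson_class (poly_ring V) (F * g)"
proof -
  let ?S = "poly_ring V :: (point, 'k) mpoly ring"
  have Fg: "F * g \<in> carrier ?S" using F g by (simp add: carrier_mult)
  have "colon_ideal ?S (Idl\<^bsub>?S\<^esub> {F * g}) (Idl\<^bsub>?S\<^esub> {g}) = Idl\<^bsub>?S\<^esub> {F}"
  proof (intro equalityI subsetI)
    fix p assume "p \<in> colon_ideal ?S (Idl\<^bsub>?S\<^esub> {F * g}) (Idl\<^bsub>?S\<^esub> {g})"
    moreover have "g \<in> Idl\<^bsub>?S\<^esub> {g}"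
      unfolding Idl_single[OF g(1)] by (intro CollectI exI[of _ 1]) simp
    ultimately have p: "p \<in> carrier ?S" "p * g \<in> Idl\<^bsub>?S\<^esub> {F * g}"
      by (auto simp: colon_ideal_def)
    then obtain q where q: "q \<in> carrier ?S" "p * g = q * (F * g)"
      by (auto simp: Idl_single[OF Fg])
    then have "(p - q * F) * g = 0" by (simp add: algebra_simps)
    then have "p = q * F" using mult_eq_0_point g(2) by fastforce
    then show "p \<in> Idl\<^bsub>?S\<^esub> {F}" using q by (auto simp: Idl_single[OF F])
  next
    fix p assume "p \<in> Idl\<^bsub>?S\<^esub> {F}"
    then obtain q where q: "q \<in> carrier ?S" "p = q * F" by (auto simp: Idl_single[OF F])
    have "p * (t * g) \<in> Idl\<^bsub>?S\<^esub> {F * g}" if "t \<in> carrier ?S" for t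
      unfolding Idl_single[OF Fg]
      by (intro CollectI exI[of _ "q * t"]) (use q that in \<open>simp add: carrier_mult mult_ac\<close>)
    then show "p \<in> colon_ideal ?S (Idl\<^bsub>?S\<^esub> {F * g}) (Idl\<^bsub>?S\<^esub> {g})"
      using q F by (auto simp: colon_ideal_def Idl_single[OF g(1)] carrier_mult)
  qed
  then show ?thesis
    using knutson_class.colon[OF knutson_class.principal[of ?S "F * g"] ideal_Idl_single[OF g(1)]] by simp
qed

text \<open>The zero ideal need not belong to the class, but it behaves like a member under sums.\<close>

definition knutson_class0 :: "point set \<Rightarrow> (point, 'k::field) mpoly \<Rightarrow> (point, 'k) mpoly set set" where
  "knutson_class0 V f = insert {0} (knutson_class (poly_ring V) f)"

lemma knutson_class0_add:
  assumes "A \<in> knutson_class0 V f" "B \<in> knutson_class0 V f"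
  shows "A <+>\<^bsub>poly_ring V\<^esub> B \<in> knutson_class0 V f"
  using assms knutson_class.sum[of A "poly_ring V" f B]
  by (auto simp: knutson_class0_def) (auto simp: set_add_poly_ring)

text \<open>Identifies the ideal J generated by \<open>G\<close> with (A + (F)) : (h). One inclusion
  holds since J contains A + (F) and \<open>h\<close> can be cancelled modulo J, the other since
  \<open>h\<close> carries every generator into A + (F). The hypothesis \<open>gen\<close> speaks of
  all ideals containing \<open>A\<close> and \<open>F\<close>, which avoids naming the sum.\<close>

lemma knutson_class_saturate:
  fixes f :: "(point, 'k::field) mpoly"
  assumes A: "A \<in> knutson_class0 V f" "poly_ideal V A"
    and F: "F \<in> carrier (poly_ring V)" "Idl\<^bsub>poly_ring V\<^esub> {F} \<in> knutson_class (poly_ring V) f"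
    and h: "h \<in> carrier (poly_ring V)" and G: "G \<subseteq> carrier (poly_ring V)"
    and sub: "A \<subseteq> Idl\<^bsub>poly_ring V\<^esub> G" "F \<in> Idl\<^bsub>poly_ring V\<^esub> G"
    and nzd: "\<And>p. p \<in> carrier (poly_ring V) \<Longrightarrow> p * h \<in> Idl\<^bsub>poly_ring V\<^esub> G \<Longrightarrow> p \<in> Idl\<^bsub>poly_ring V\<^esub> G"
    and gen: "\<And>p B. p \<in> G \<Longrightarrow> poly_ideal V B \<Longrightarrow> A \<subseteq> B \<Longrightarrow> F \<in> B \<Longrightarrow> p * h \<in> B"
  shows "Idl\<^bsub>poly_ring V\<^esub> G \<in> knutson_class (poly_ring V) f"
proof -
  let ?S = "poly_ring V :: (point, 'k) mpoly ring"
  interpret S: cring ?S by (rule cring_poly_ring)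
  interpret A: poly_ideal V A by (rule A(2))
  define B where "B = A <+>\<^bsub>?S\<^esub> Idl\<^bsub>?S\<^esub> {F}"
  interpret B: poly_ideal V B
    unfolding B_def by (rule poly_ideal.intro) (intro S.add_ideals A.is_ideal ideal_Idl_single F)
  interpret J: poly_ideal V "Idl\<^bsub>?S\<^esub> G"
    by (rule poly_ideal.intro) (intro S.genideal_ideal G)
  have FF: "F \<in> Idl\<^bsub>?S\<^esub> {F}"
    unfolding Idl_single[OF F(1)] by (intro CollectI exI[of _ 1]) simp
  have sum: "p + q \<in> B" if "p \<in> A" "q \<in> Idl\<^bsub>?S\<^esub> {F}" for p q
    unfolding B_def set_add_poly_ring using that by blast
  have "0 \<in> Idl\<^bsub>?S\<^esub> {F}"
    unfolding Idl_single[OF F(1)] by (intro CollectI exI[of _ 0]) simp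
  then have AB: "A \<subseteq> B" using sum[of _ 0] by auto
  have FB: "F \<in> B" using sum[OF A.zero_mem FF] by simp
  have BJ: "B \<subseteq> Idl\<^bsub>?S\<^esub> G"
    unfolding B_def set_add_poly_ring using sub F(1) by (auto simp: Idl_single intro!: J.add_mem J.mult_mem)
  \<comment> \<open>If \<open>A\<close> is the zero ideal, the sum is just (F), which is in the
    class; so the result lies in the class proper.\<close>
  have "A = {0} \<Longrightarrow> B = Idl\<^bsub>?S\<^esub> {F}"
    by (auto simp: B_def set_add_poly_ring)
  then have Bk: "B \<in> knutson_class ?S f"
    using A(1) F(2) knutson_class.sum[of A ?S f "Idl\<^bsub>?S\<^esub> {F}"]
    by (auto simp: knutson_class0_def B_def)
  have colon: "colon_ideal ?S B (Idl\<^bsub>?S\<^esub> {h}) = {p \<in> carrier ?S. p * h \<in> B}"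
  proof (intro equalityI subsetI)
    fix p assume "p \<in> colon_ideal ?S B (Idl\<^bsub>?S\<^esub> {h})"
    moreover have "h \<in> Idl\<^bsub>?S\<^esub> {h}"
      unfolding Idl_single[OF h] by (intro CollectI exI[of _ 1]) simp
    ultimately show "p \<in> {p \<in> carrier ?S. p * h \<in> B}"
      by (auto simp: colon_ideal_def)
  next
    fix p assume p: "p \<in> {p \<in> carrier ?S. p * h \<in> B}"
    have "p * (t * h) \<in> B" if "t \<in> carrier ?S" for t
      using B.mult_mem[OF that, of "p * h"] p by (simp add: mult_ac)
    then show "p \<in> colon_ideal ?S B (Idl\<^bsub>?S\<^esub> {h})"
      using p by (auto simp: colon_ideal_def Idl_single[OF h])
  qed
  have "colon_ideal ?S B (Idl\<^bsub>?S\<^esub> {h}) = Idl\<^bsub>?S\<^esub> G"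
  proof
    show "colon_ideal ?S B (Idl\<^bsub>?S\<^esub> {h}) \<subseteq> Idl\<^bsub>?S\<^esub> G"
      unfolding colon using BJ nzd by auto
    have "ideal {p \<in> carrier ?S. p * h \<in> B} ?S"
    proof (rule idealI)
      show "subgroup {p \<in> carrier ?S. p * h \<in> B} (add_monoid ?S)"
      proof (rule S.add.subgroupI)
        fix a assume a: "a \<in> {p \<in> carrier ?S. p * h \<in> B}"
        then have "\<ominus>\<^bsub>?S\<^esub> a = - a"
          using S.minus_equality[of "- a" a] by (auto simp: carrier_uminus)
        with a B.uminus_mem[of "a * h"] show "\<ominus>\<^bsub>?S\<^esub> a \<in> {p \<in> carrier ?S. p * h \<in> B}"
          by (simp add: carrier_uminus)
      qed (auto simp: distrib_right carrier_add B.add_mem intro!: exI[of _ 0])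
    next
      fix a x assume a: "a \<in> {p \<in> carrier ?S. p * h \<in> B}" and x: "x \<in> carrier ?S"
      then have "x * (a * h) \<in> B" using B.mult_mem by blast
      then show "x \<otimes>\<^bsub>?S\<^esub> a \<in> {p \<in> carrier ?S. p * h \<in> B}"
        "a \<otimes>\<^bsub>?S\<^esub> x \<in> {p \<in> carrier ?S. p * h \<in> B}"
        using a x by (simp_all add: carrier_mult mult_ac)
    qed (rule S.ring_axioms)
    moreover have "G \<subseteq> {p \<in> carrier ?S. p * h \<in> B}"
      using G gen[OF _ B.poly_ideal_axioms AB FB] by auto
    ultimately show "Idl\<^bsub>?S\<^esub> G \<subseteq> colon_ideal ?S B (Idl\<^bsub>?S\<^esub> {h})"
      unfolding colon by (rule S.genideal_minimal)
  qed
  then show ?thesis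
    using knutson_class.colon[OF Bk ideal_Idl_single[OF h]] by simp
qed

subsection \<open>Chain determinants and the cells of one side\<close>

context chains
begin

abbreviation V :: "point set" where "V \<equiv> vertices P"

text \<open>A point outside \<open>V\<close> has no indeterminate in the ring. On a closed side one
  triangle of the matrix and both entries next to each diagonal step are genuine indeterminates, and
  only these enter the elimination relations.\<close>

definition entry :: "nat \<Rightarrow> nat \<Rightarrow> nat \<Rightarrow> (point, 'k::field) mpoly" where
  "entry k i j = (if (px k i, py k j) \<in> V then indet (px k i, py k j) else 0)"

definition chain_det :: "nat \<Rightarrow> (point, 'k::field) mpoly" where
  "chain_det k = det (mat (len k) (len k) (\<lambda>(i, j). entry k i j))"

lemma entry_carrier: "entry k i j \<in> carrier (poly_ring V)"
  by (simp add: entry_def)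

lemma chain_det_carrier: "chain_det k \<in> carrier (poly_ring V)"
  unfolding chain_det_def by (rule det_carrier[OF mat_carrier]) (simp add: entry_carrier)

lemma chain_vertex: "k < length Vs \<Longrightarrow> i < len k \<Longrightarrow> (px k i, py k i) \<in> V"
  using chain_vertices[of k] mem_chain_iff by blast

lemma leads_chain_det:
  assumes "k < length Vs"
  shows "leads (\<Sum>i<len k. single (px k i, py k i) 1) (chain_det k)"
  unfolding chain_det_def
  by (rule leads_det[of _ _ "px k 0" _ "py k 0"])
    (use assms px_eq py_eq chain_vertex in \<open>auto simp: entry_def\<close>)

lemma chain_cell_vertices:
  assumes "k < length Vs" "Suc i < len k"
  shows "(px k i, py k (Suc i)) \<in> V" "(px k (Suc i), py k i) \<in> V"
  using chain_step[OF assms] by (auto simp: mem_vertices_iff)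

text \<open>The cells of the chain form the layer \<open>j = i + 1\<close>; every further layer
  follows by closedness from two neighbours in the preceding one.\<close>

lemma lower_triangle:
  assumes R: "loc_closed True R" and k: "k < length Vs" "chain_cells P (Vs ! k) \<subseteq> R"
  shows "i < j \<Longrightarrow> j < len k \<Longrightarrow> (px k i, py k j) \<in> R"
proof (induction "j - i" arbitrary: i j rule: less_induct)
  case less
  then obtain j' where j': "j = Suc j'" by (cases j) auto
  show ?case
  proof (cases "i = j'")
    case True
    then have "(px k i, py k j) \<in> chain_cells P (Vs ! k)"
      using less.prems j' mem_chain_cells_iff[OF k(1)] by auto
    then show ?thesis using k by auto
  next
    case False
    then have i: "i < j'" using less.prems j' by auto
    have "(px k i, py k j') \<in> R" using less.prems i j' by (intro less.hyps) auto
    then have 1: "(px k i, Suc (py k j)) \<in> R"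
      using chain_step(3)[OF k(1), of j'] less.prems j' by simp
    have "(px k (Suc i), py k j) \<in> R" using less.prems i j' by (intro less.hyps) auto
    then have 2: "(Suc (px k i), py k j) \<in> R"
      using chain_step(2)[OF k(1), of i] less.prems j' by simp
    show ?thesis using loc_closed_TrueD[OF R 1 2] .
  qed
qed

text \<open>The layers start with the cells of the chain at \<open>i = j\<close>. The upper right
  vertex of the cell is \<open>(px k (Suc j), py k i)\<close>, whence the shifted indices.\<close>

lemma upper_triangle:
  assumes R: "loc_closed False R" and k: "k < length Vs" "chain_cells P (Vs ! k) \<subseteq> R"
  shows "i \<le> j \<Longrightarrow> Suc j < len k \<Longrightarrow> (px k j, py k (Suc i)) \<in> R"
proof (induction "j - i" arbitrary: i j rule: less_induct)
  case less
  show ?case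
  proof (cases "i = j")
    case True
    then have "(px k j, py k (Suc i)) \<in> chain_cells P (Vs ! k)"
      using less.prems mem_chain_cells_iff[OF k(1)] by auto
    then show ?thesis using k by auto
  next
    case False
    then obtain j' where j': "j = Suc j'" "i \<le> j'" using less.prems by (cases j) auto
    have "(px k j', py k (Suc i)) \<in> R" using less.prems j' by (intro less.hyps) auto
    then have 1: "(px k j', Suc (py k (Suc (Suc i)))) \<in> R"
      using chain_step(3)[OF k(1), of "Suc i"] less.prems j' by simp
    have "(px k j, py k (Suc (Suc i))) \<in> R" using less.prems j' by (intro less.hyps) auto
    then have 2: "(Suc (px k j'), py k (Suc (Suc i))) \<in> R"
      using chain_step(2)[OF k(1), of j'] less.prems j' by simp
    show ?thesis
      using loc_closed_FalseD[OF R 1 2] chain_step(2)[OF k(1), of j']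
        chain_step(3)[OF k(1), of "Suc i"] less.prems j' by simp
  qed
qed

definition clev :: "bool \<Rightarrow> nat \<Rightarrow> int" where
  "clev s k = (if s then int (px k 0 + py k 0) - 1 else 1 - int (px k 0 + py k 0))"

lemma lev_chain_cell:
  assumes "k < length Vs" "C \<in> chain_cells P (Vs ! k)"
  shows "lev s C = clev s k"
  using chain_cell_sum[of k "fst C" "snd C"] assms by (auto simp: lev_def clev_def)

text \<open>These rectangles, one cell thick, carry the relations required by
  \<open>det_chain_mem\<close>. They stop just short of the cell of the chain, so all their cells
  have strictly smaller level.\<close>

lemma rect_triangle:
  assumes R: "loc_closed s R" and k: "k < length Vs" "chain_cells P (Vs ! k) \<subseteq> R"
    and ij: "Suc i < j" "j < len k"
    and X: "X = {C \<in> R. lev s C < clev s k}"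
  shows "if s then {px k i..<px k (Suc i)} \<times> {py k j..<py k (Suc i)} \<subseteq> X
    else {px k (Suc i)..<px k j} \<times> {py k (Suc i)..<py k i} \<subseteq> X"
proof (cases s)
  case True
  have "(x, y) \<in> X" if x: "px k i \<le> x" "x < px k (Suc i)" and y: "py k j \<le> y" "y < py k (Suc i)" for x y
  proof -
    have x': "x = px k i" using x chain_step(2)[OF k(1), of i] ij by simp
    define l where "l = py k 0 - y"
    have py: "py k j + j = py k 0" "py k (Suc i) + Suc i = py k 0"
      using py_eq[OF k(1), of j] py_eq[OF k(1), of "Suc i"] ij by auto
    then have l: "l \<le> j" "Suc i < l" "y + l = py k 0" using y by (auto simp: l_def)
    then have y': "y = py k l" using py_eq[OF k(1), of l] ij by simp
    have "(x, y) \<in> R" unfolding x' y'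
      using lower_triangle[OF _ k, of i l] R True l ij by auto
    moreover have "x + y < px k 0 + py k 0 - 1"
      using x' px_eq[OF k(1), of i] l ij by simp
    ultimately show ?thesis using True by (simp add: X lev_def clev_def)
  qed
  then show ?thesis using True by auto
next
  case False
  have "(x, y) \<in> X" if x: "px k (Suc i) \<le> x" "x < px k j" and y: "py k (Suc i) \<le> y" "y < py k i" for x y
  proof -
    have y': "y = py k (Suc i)" using y chain_step(3)[OF k(1), of i] ij by simp
    define l where "l = x - px k 0"
    have "px k j = px k 0 + j" "px k (Suc i) = px k 0 + Suc i"
      using px_eq[OF k(1), of j] px_eq[OF k(1), of "Suc i"] ij by auto
    then have l: "l < j" "Suc i \<le> l" "x = px k 0 + l" using x by (auto simp: l_def)
    then have x': "x = px k l" using px_eq[OF k(1), of l] ij by simp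
    have "(x, y) \<in> R" unfolding x' y'
      using upper_triangle[OF _ k, of i l] R False l ij by auto
    moreover have "px k 0 + py k 0 - 1 < x + y"
      using l y' py_eq[OF k(1), of "Suc i"] ij by simp
    ultimately show ?thesis using False by (simp add: X lev_def clev_def)
  qed
  then show ?thesis using False by auto
qed

text \<open>Since \<open>py k\<close> decreases along the chain, this is minus the inner binomial of
  the cell; it is also a diagonal 2-minor of the chain matrix.\<close>

definition gen :: "nat \<Rightarrow> nat \<Rightarrow> (point, 'k::field) mpoly" where
  "gen k i = minor (px k i) (px k (Suc i)) (py k i) (py k (Suc i))"

lemma gen_carrier: "k < length Vs \<Longrightarrow> Suc i < len k \<Longrightarrow> gen k i \<in> carrier (poly_ring V)"
  unfolding gen_def using chain_cell_vertices chain_vertex by (intro minor_carrier) auto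

lemma chain_det_factor:
  fixes I :: "(point, 'k::field) mpoly set"
  assumes R: "loc_closed s R" "R \<subseteq> P" and k: "k < length Vs" "chain_cells P (Vs ! k) \<subseteq> R"
    and X: "X = {C \<in> R. lev s C < clev s k}"
    and I: "poly_ideal V I" "polyomino_ideal (poly_ring V) X \<subseteq> I"
  shows "(\<Prod>i\<in>{1..<len k}. indet (px k i, py k i)) * chain_det k -
    (\<Prod>i<len k - 1. gen k i) * indet (px k (len k - 1), py k (len k - 1)) \<in> I"
proof -
  interpret poly_ideal V I by (rule I(1))
  define n where "n = len k"
  have n: "0 < n" using chain_nonempty[OF k(1)] by (simp add: n_def)
  \<comment> \<open>The elimination uses entries with \<open>i \<le> j\<close>. For
    \<open>\<not> s\<close> the filled triangle is on the other side of the diagonal, so the matrix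
    is transposed.\<close>
  define M :: "nat \<Rightarrow> nat \<Rightarrow> (point, 'k) mpoly" where
    "M i j = (if s then entry k i j else entry k j i)" for i j
  have XV: "vertices X \<subseteq> V" using R(2) by (intro vertices_mono) (auto simp: X)
  have low: "(entry k i j :: (point, 'k) mpoly) = indet (px k i, py k j)" if "i \<le> j" "j < n" s for i j
  proof (cases "i = j")
    case True
    then show ?thesis using chain_vertex[OF k(1), of i] that by (simp add: entry_def n_def)
  next
    case False
    then have "(px k i, py k j) \<in> R" using lower_triangle[OF _ k, of i j] R(1) that by (simp add: n_def)
    then have "(px k i, py k j) \<in> V" using R(2) by (auto simp: mem_vertices_iff)
    then show ?thesis by (simp add: entry_def)
  qed
  have upp: "(entry k j i :: (point, 'k) mpoly) = indet (px k j, py k i)" if "i \<le> j" "j < n" "\<not> s" for i j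
  proof (cases "i = j")
    case True
    then show ?thesis using chain_vertex[OF k(1), of i] that by (simp add: entry_def n_def)
  next
    case False
    with that have "i < j" by simp
    then obtain j' where j': "j = Suc j'" "i \<le> j'" by (cases j) auto
    then have "(px k j', py k (Suc i)) \<in> R" using upper_triangle[OF _ k, of i j'] R(1) that by (simp add: n_def)
    then have "(Suc (px k j'), Suc (py k (Suc i))) \<in> V" using R(2) by (auto simp: mem_vertices_iff)
    then have "(px k j, py k i) \<in> V"
      using chain_step(2)[OF k(1), of j'] chain_step(3)[OF k(1), of i] j' that by (simp add: n_def)
    then show ?thesis by (simp add: entry_def)
  qed
  have near: "(entry k i i :: (point, 'k) mpoly) = indet (px k i, py k i)" if "i < n" for i
    using chain_vertex[OF k(1), of i] that by (simp add: entry_def n_def)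
  have near': "(entry k i (Suc i) :: (point, 'k) mpoly) = indet (px k i, py k (Suc i))"
    "(entry k (Suc i) i :: (point, 'k) mpoly) = indet (px k (Suc i), py k i)"
    if "Suc i < n" for i
    using chain_cell_vertices[OF k(1), of i] that by (simp_all add: entry_def n_def)
  have g: "M i i * M (Suc i) (Suc i) - M i (Suc i) * M (Suc i) i = gen k i" if "Suc i < n" for i
    using near[of i] near[of "Suc i"] near'[of i] that by (simp add: M_def gen_def minor_def mult.commute)
  have "(\<Prod>i\<in>{1..<n}. M i i) * det (mat n n (\<lambda>(i, j). M i j)) -
    (\<Prod>i<n - 1. M i i * M (Suc i) (Suc i) - M i (Suc i) * M (Suc i) i) * M (n - 1) (n - 1) \<in> I"
  proof (rule det_chain_mem[OF n])
    fix i j assume "i < n" "j < n"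
    then show "M i j \<in> carrier (poly_ring V)" by (simp add: M_def entry_carrier)
  next
    fix i j assume ij: "Suc i < j" "j < n"
    have rect: "if s then {px k i..<px k (Suc i)} \<times> {py k j..<py k (Suc i)} \<subseteq> X
        else {px k (Suc i)..<px k j} \<times> {py k (Suc i)..<py k i} \<subseteq> X"
      using rect_triangle[OF R(1) k ij(1) _ X] ij by (simp add: n_def)
    have px: "px k i \<le> px k (Suc i)" "px k (Suc i) \<le> px k j"
      using px_eq[OF k(1), of i] px_eq[OF k(1), of "Suc i"] px_eq[OF k(1), of j] ij by (auto simp: n_def)
    have py: "py k j \<le> py k (Suc i)" "py k (Suc i) \<le> py k i"
      using py_eq[OF k(1), of i] py_eq[OF k(1), of "Suc i"] py_eq[OF k(1), of j] ij by (auto simp: n_def)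
    show "M i j * M (Suc i) (Suc i) - M i (Suc i) * M (Suc i) j \<in> I"
    proof (cases s)
      case True
      have "minor (px k i) (px k (Suc i)) (py k j) (py k (Suc i)) \<in> I"
        using rect True px py I(2) by (intro subsetD[OF I(2)] minor_mem_polyomino_ideal[OF XV]) auto
      then show ?thesis
        using True ij low[of i j] low[of "Suc i" j] low[of "Suc i" "Suc i"] low[of i "Suc i"]
        by (simp add: M_def minor_def)
    next
      case False
      have "minor (px k j) (px k (Suc i)) (py k i) (py k (Suc i)) \<in> I"
        using rect False px py I(2) by (intro subsetD[OF I(2)] minor_mem_polyomino_ideal[OF XV]) auto
      then show ?thesis
        using False ij upp[of i j] upp[of "Suc i" j] upp[of "Suc i" "Suc i"] upp[of i "Suc i"]
        by (simp add: M_def minor_def mult.commute)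
    qed
  qed
  moreover have "det (mat n n (\<lambda>(i, j). M i j)) = chain_det k"
  proof (cases s)
    case True
    then show ?thesis by (simp add: M_def chain_det_def n_def)
  next
    case False
    have "mat n n (\<lambda>(i, j). M i j) = transpose_mat (mat n n (\<lambda>(i, j). entry k i j))"
      by (intro eq_matI) (auto simp: M_def False)
    then show ?thesis
      using det_transpose[OF mat_carrier] by (simp add: chain_det_def n_def)
  qed
  moreover have "(\<Prod>i\<in>{1..<n}. M i i) = (\<Prod>i\<in>{1..<n}. indet (px k i, py k i))"
    by (intro prod.cong) (auto simp: M_def near)
  moreover have "(\<Prod>i<n - 1. M i i * M (Suc i) (Suc i) - M i (Suc i) * M (Suc i) i) = (\<Prod>i<n - 1. gen k i)"
    by (intro prod.cong) (auto simp: g)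
  moreover have "M (n - 1) (n - 1) = indet (px k (n - 1), py k (n - 1))"
    using n by (simp add: M_def near)
  ultimately show ?thesis by (simp add: n_def)
qed

end

text \<open>Here a and b are opposite corners of a new cell and u is the far corner of a larger
  rectangle ending at b. Up to the factor at a, its binomial reduces to that of the cell and those
  of two rectangles that avoid the cell.\<close>

lemma minor_exchange:
  "indet (ax, ay) * minor ux bx uy by = indet (ux, uy) * minor ax bx ay by +
     indet (bx, ay) * minor ux ax uy by + indet (ux, by) * minor ax bx uy ay"
  by (simp add: minor_def algebra_simps)

text \<open>The row label of the isolated vertex \<open>t\<close> is borne by \<open>t\<close>
  alone, so the monomial map separates the two terms.\<close>

lemma binomial_notin_polyomino_ideal:
  fixes t u v x y :: point
  assumes X: "vertices X \<subseteq> V" and t: "t \<notin> vertices X" "t \<noteq> u" "t \<noteq> v"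
  shows "(indet u * indet v - indet x * indet t :: (point, 'k::field) mpoly) \<notin> polyomino_ideal (poly_ring V) X"
proof
  let ?m = "single x 1 + single t 1 :: point monom" and ?n = "single u 1 + single v 1 :: point monom"
  assume "(indet u * indet v - indet x * indet t :: (point, 'k) mpoly) \<in> polyomino_ideal (poly_ring V) X"
  from polyomino_ideal_push[OF X this]
  have "(mon (seg_monom X ?n) :: (nat, 'k) mpoly) = mon (seg_monom X ?m)"
    by (simp add: indet_def mult_single push_diff)
  then have "keys (mon (seg_monom X ?n) :: (nat, 'k) mpoly) = keys (mon (seg_monom X ?m) :: (nat, 'k) mpoly)"
    by simp
  then have "seg_monom X ?m = seg_monom X ?n" by simp
  moreover have "t \<in> keys ?m" by (simp add: keys_add_nat)
  ultimately obtain c where "c \<in> keys ?n" "hlabel X c = hlabel X t"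
    using label_monom_eq_imp(1) by metis
  then have "c = t" using hlabel_isolated[OF t(1)] by blast
  with \<open>c \<in> keys ?n\<close> t show False by (simp add: keys_add_nat)
qed

text \<open>An interval containing the new cell must have it as its extreme corner cell: a further
  neighbour in that direction would be a cell of \<open>X\<close> of larger level. Hence b is a
  corner of the interval.\<close>

lemma inner_binomials_insert_cases:
  assumes p: "p \<in> inner_binomials (insert (cx, cy) X)"
    and X: "\<And>C. C \<in> X \<Longrightarrow> lev s C < lev s (cx, cy)"
    and ab: "(if s then ax = cx \<and> ay = cy \<and> bx = Suc cx \<and> by = Suc cy
      else ax = Suc cx \<and> ay = Suc cy \<and> bx = cx \<and> by = cy)"
  obtains "p \<in> inner_binomials X"
  | ux uy where "p = minor ux bx uy by"
      "{min ux ax..<max ux ax} \<times> {min uy by..<max uy by} \<subseteq> X"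
      "{min ax bx..<max ax bx} \<times> {min uy ay..<max uy ay} \<subseteq> X"
      "(ux, uy) \<in> vertices (insert (cx, cy) X)" "(ux, by) \<in> vertices (insert (cx, cy) X)"
proof -
  obtain x1 x2 y1 y2 where p: "p = minor x1 x2 y1 y2" and lt: "x1 < x2" "y1 < y2"
    and sub: "{x1..<x2} \<times> {y1..<y2} \<subseteq> insert (cx, cy) X"
    using p unfolding inner_binomials_eq by blast
  show thesis
  proof (cases "(cx, cy) \<in> {x1..<x2} \<times> {y1..<y2}")
    case False
    then have "{x1..<x2} \<times> {y1..<y2} \<subseteq> X" using sub by blast
    then have "p \<in> inner_binomials X" unfolding inner_binomials_eq using p lt by blast
    then show thesis by (rule that(1))
  next
    case True
    then have c: "x1 \<le> cx" "cx < x2" "y1 \<le> cy" "cy < y2" by auto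
    have inX: "(x, y) \<in> X" if "x1 \<le> x" "x < x2" "y1 \<le> y" "y < y2" "x \<noteq> cx \<or> y \<noteq> cy" for x y
    proof -
      have "(x, y) \<in> {x1..<x2} \<times> {y1..<y2}" using that by auto
      then have "(x, y) \<in> insert (cx, cy) X" using sub by blast
      then show ?thesis using that(5) by auto
    qed
    note vert = rect_vertices[OF lt sub]
    show thesis
    proof (cases s)
      case True
      have "x2 = Suc cx"
        using inX[of "Suc cx" cy] X[of "(Suc cx, cy)"] c True by (fastforce simp: lev_def)
      moreover have "y2 = Suc cy"
        using inX[of cx "Suc cy"] X[of "(cx, Suc cy)"] c True by (fastforce simp: lev_def)
      ultimately show thesis
        using ab True c p vert inX by (intro that(2)[of x1 y1]) auto
    next
      case False
      have "x1 = cx"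
        using inX[of "cx - 1" cy] X[of "(cx - 1, cy)"] c False by (fastforce simp: lev_def)
      moreover have "y1 = cy"
        using inX[of cx "cy - 1"] X[of "(cx, cy - 1)"] c False by (fastforce simp: lev_def)
      ultimately show thesis
        using ab False c p vert inX minor_swap
        by (intro that(2)[of x2 y2]) (auto simp: minor_def mult.commute)
    qed
  qed
qed

text \<open>The cell required by closedness has strictly smaller level than the two given ones, so a
  single cell of top level may be retained.\<close>

lemma loc_closed_initial:
  assumes R: "loc_closed s R" and C: "C \<in> R"
  shows "loc_closed s (insert C {C' \<in> R. lev s C' < lev s C})"
  unfolding loc_closed_def
proof (intro allI impI, elim conjE)
  fix x y
  let ?X = "insert C {C' \<in> R. lev s C' < lev s C}" and ?z = "if s then (x, y) else (Suc x, Suc y)"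
  assume xy: "(x, Suc y) \<in> ?X" "(Suc x, y) \<in> ?X"
  then have "(x, Suc y) \<in> R" "(Suc x, y) \<in> R" using C by auto
  then have "?z \<in> R" using R unfolding loc_closed_def by blast
  moreover have "lev s ?z < lev s (x, Suc y)" by (simp add: lev_def)
  moreover have "lev s (x, Suc y) \<le> lev s C" using xy by auto
  ultimately show "?z \<in> ?X" by auto
qed

section \<open>Adjoining cells level by level\<close>

context chains
begin

lemma add_cell_in_class:
  fixes f :: "(point, 'k::field) mpoly"
  assumes R: "loc_closed s R" "R \<subseteq> P"
    and k: "k < length Vs" "C \<in> chain_cells P (Vs ! k)" "chain_cells P (Vs ! k) \<subseteq> R"
    and X: "X = {C' \<in> R. lev s C' < lev s C}"
    and det: "Idl\<^bsub>poly_ring V\<^esub> {chain_det k} \<in> knutson_class (poly_ring V) f"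
    and A: "polyomino_ideal (poly_ring V) X \<in> knutson_class0 V f"
  shows "polyomino_ideal (poly_ring V) (insert C X) \<in> knutson_class0 V f"
proof -
  let ?S = "poly_ring V :: (point, 'k) mpoly ring"
  let ?J = "polyomino_ideal ?S (insert C X)"
  have CR: "C \<in> R" using k by auto
  have levC: "lev s C = clev s k" using k by (intro lev_chain_cell) auto
  have X': "X = {C' \<in> R. lev s C' < clev s k}" using X levC by simp
  have XV: "vertices X \<subseteq> V" and CXV: "vertices (insert C X) \<subseteq> V"
    using R(2) CR by (auto intro!: vertices_mono simp: X)
  have closed: "loc_closed s (insert C X)"
    unfolding X using R(1) CR by (rule loc_closed_initial)
  interpret A: poly_ideal V "polyomino_ideal ?S X" using XV by (rule poly_ideal_polyomino_ideal)
  interpret J: poly_ideal V ?J using CXV by (rule poly_ideal_polyomino_ideal)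
  note prime = polyomino_ideal_prime[OF CXV closed]
  obtain i where i: "Suc i < len k" "C = (px k i, py k (Suc i))"
    using k mem_chain_cells_iff by auto
  define cx cy where "cx = px k i" and "cy = py k (Suc i)"
  have C: "C = (cx, cy)" and pxy: "px k (Suc i) = Suc cx" "py k i = Suc cy"
    using i chain_step[OF k(1) i(1)] by (auto simp: cx_def cy_def)
  \<comment> \<open>a is the corner of \<open>C\<close> facing the cells already present: lower left
    for \<open>s\<close>, upper right otherwise; b is the opposite corner.\<close>
  obtain ax ay bx "by" where ab: "(if s then ax = cx \<and> ay = cy \<and> bx = Suc cx \<and> by = Suc cy
      else ax = Suc cx \<and> ay = Suc cy \<and> bx = cx \<and> by = cy)"
    by (cases s) auto
  have CV: "(ax, ay) \<in> V" "(ax, by) \<in> V" "(bx, ay) \<in> V" "(bx, by) \<in> V"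
  proof -
    have "cell_vertices C \<subseteq> V" using CXV unfolding vertices_def by blast
    then show "(ax, ay) \<in> V" "(ax, by) \<in> V" "(bx, ay) \<in> V" "(bx, by) \<in> V"
      using ab by (auto simp: C cell_vertices_eq split: if_splits)
  qed
  have gen_i: "gen k i = - minor ax bx ay by"
    using ab by (auto simp: gen_def pxy minor_def mult.commute simp flip: cx_def cy_def split: if_splits)
  have gcarr: "gen k j \<in> carrier ?S" if "Suc j < len k" for j
    using that k(1) by (intro gen_carrier)
  define last where "last = (px k (len k - 1), py k (len k - 1))"
  have lastV: "last \<in> V"
    unfolding last_def using chain_vertex[OF k(1), of "len k - 1"] i by simp
  define rest where "rest = (\<Prod>j\<in>{..<len k - 1} - {i}. gen k j) * (indet last :: (point, 'k) mpoly)"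
  define h where "h = indet (ax, ay) * rest"
  have rest: "rest \<in> carrier ?S"
    unfolding rest_def using lastV by (intro carrier_intros gcarr) auto
  have h: "h \<in> carrier ?S"
    unfolding h_def using CV rest by (simp add: carrier_mult)
  have prod_gen: "(\<Prod>j<len k - 1. gen k j) * indet last = gen k i * rest"
    using i by (simp add: rest_def prod.remove[of _ i])
  have diag: "(\<Prod>j\<in>{1..<len k}. indet (px k j, py k j)) =
      (mon (\<Sum>j\<in>{1..<len k}. single (px k j, py k j) 1) :: (point, 'k) mpoly)"
    by (rule prod_indet) simp
  have diagV: "(\<Prod>j\<in>{1..<len k}. indet (px k j, py k j)) \<in> carrier ?S"
    using chain_vertex[OF k(1)] by (intro carrier_prod) auto
  have gen_J: "gen k i \<in> ?J"
    unfolding gen_def pxy using CXV by (intro minor_mem_polyomino_ideal) (auto simp: C simp flip: cx_def cy_def)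
  \<comment> \<open>The corner of the \<open>j\<close>-th cell pointing away from \<open>X\<close>
    is no vertex of \<open>insert C X\<close>: the four cells around it are that cell itself, which
    differs from \<open>C\<close>, and cells of larger level.\<close>
  have gen_notin: "gen k j \<notin> ?J" if j: "Suc j < len k" "j \<noteq> i" for j
  proof -
    define x y where "x = px k j" and "y = py k (Suc j)"
    have pj: "px k (Suc j) = Suc x" "py k j = Suc y"
      using chain_step[OF k(1) j(1)] by (auto simp: x_def y_def)
    have "(x, y) \<in> chain_cells P (Vs ! k)"
      using mem_chain_cells_iff[OF k(1)] j by (auto simp: x_def y_def)
    then have levj: "lev s (x, y) = lev s C" using lev_chain_cell k(1) levC by simp
    then have xyC: "int (fst C) + int (snd C) = int x + int y"
      by (auto simp: lev_def split: if_splits)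
    have ne: "(x, y) \<noteq> C"
      using px_eq[OF k(1), of j] px_eq[OF k(1), of i] i j by (auto simp: x_def)
    have le: "C' = C \<or> lev s C' < lev s (x, y)" if "C' \<in> insert C X" for C'
      using that by (auto simp: X levj)
    have out: "C' \<notin> insert C X" if "lev s (x, y) \<le> lev s C'" "C' = (x, y) \<or> lev s C' \<noteq> lev s C" for C'
      using le[of C'] that ne by auto
    show ?thesis
    proof (cases s)
      case True
      have "(Suc x, Suc y) \<notin> vertices (insert C X)"
        using out[of "(x, y)"] out[of "(Suc x, y)"] out[of "(x, Suc y)"] out[of "(Suc x, Suc y)"] True
        unfolding mem_vertices_iff by (simp add: lev_def xyC)
      then show ?thesis
        using binomial_notin_polyomino_ideal[OF CXV, of "(Suc x, Suc y)" "(x, Suc y)" "(Suc x, y)" "(x, y)"]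
        by (simp add: gen_def pj minor_def flip: x_def y_def)
    next
      case False
      have below: "(u, v) \<notin> insert C X" if "u + v < x + y" for u v
        using out[of "(u, v)"] that xyC False by (auto simp: lev_def)
      have "(x, y) \<notin> vertices (insert C X)"
        using out[of "(x, y)"] below[of "x - 1" y] below[of x "y - 1"] below[of "x - 1" "y - 1"]
        unfolding mem_vertices_iff by fastforce
      then show ?thesis
        using binomial_notin_polyomino_ideal[OF CXV, of "(x, y)" "(x, Suc y)" "(Suc x, y)" "(Suc x, Suc y)"]
        by (simp add: gen_def pj minor_def mult.commute flip: x_def y_def)
    qed
  qed
  have indet_notin: "indet v \<notin> ?J" for v
    unfolding indet_def by (rule mon_notin_polyomino_ideal[OF CXV])
  have "(\<Prod>j\<in>D. gen k j) \<notin> ?J" if "finite D" "D \<subseteq> {..<len k - 1} - {i}" for D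
    using that
  proof (induction D rule: finite_induct)
    case empty
    then show ?case using mon_notin_polyomino_ideal[OF CXV, of 0] by simp
  next
    case (insert j D)
    have j: "Suc j < len k" "j \<noteq> i" using insert.prems by auto
    have "(\<Prod>j\<in>D. gen k j) \<in> carrier ?S"
      using insert by (intro carrier_prod gcarr) auto
    then show ?case
      using insert prime[of "gen k j" "\<Prod>j\<in>D. gen k j"] gen_notin[OF j] gcarr[OF j(1)] by auto
  qed
  then have "(\<Prod>j\<in>{..<len k - 1} - {i}. gen k j) \<notin> ?J" by simp
  then have "rest \<notin> ?J"
    unfolding rest_def using prime indet_notin lastV gcarr by (metis (no_types, lifting) DiffD1 carrier_indet carrier_prod lessThan_iff less_diff_conv Suc_eq_plus1)
  then have h_notin: "h \<notin> ?J"
    unfolding h_def using prime indet_notin CV(1) rest carrier_indet by metis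
  have factor: "(\<Prod>j\<in>{1..<len k}. indet (px k j, py k j)) * chain_det k - gen k i * rest \<in> I"
    if "poly_ideal V I" "polyomino_ideal ?S X \<subseteq> I" for I
    using chain_det_factor[OF R k(1,3) X' that] unfolding last_def[symmetric] prod_gen .
  have XJ: "polyomino_ideal ?S X \<subseteq> ?J"
    using CXV by (intro polyomino_ideal_mono) auto
  have "?J \<in> knutson_class ?S f"
  proof (rule knutson_class_saturate[OF A A.poly_ideal_axioms chain_det_carrier det h
        inner_binomials_carrier[OF CXV], folded polyomino_ideal_def])
    show "polyomino_ideal ?S X \<subseteq> ?J" by (rule XJ)
    \<comment> \<open>The binomial of \<open>C\<close> divides the second term, so a monomial times
      \<open>chain_det k\<close> is in \<open>?J\<close>; that ideal is prime and contains no
      monomial.\<close>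
    have "(\<Prod>j\<in>{1..<len k}. indet (px k j, py k j)) * chain_det k - gen k i * rest \<in> ?J"
      using J.poly_ideal_axioms XJ by (rule factor)
    moreover have "gen k i * rest \<in> ?J"
      using J.mult_mem[OF rest gen_J] by (simp add: mult.commute)
    ultimately have "(\<Prod>j\<in>{1..<len k}. indet (px k j, py k j)) * chain_det k \<in> ?J"
      using J.diff_mem_iff by blast
    then show "chain_det k \<in> ?J"
      using prime[OF diagV chain_det_carrier] mon_notin_polyomino_ideal[OF CXV] unfolding diag by blast
    show "p \<in> ?J" if "p \<in> carrier ?S" "p * h \<in> ?J" for p
      using prime[OF that(1) h that(2)] h_notin by blast
    fix p :: "(point, 'k) mpoly" and B assume p: "p \<in> inner_binomials (insert C X)" and "poly_ideal V B"
      and B: "polyomino_ideal ?S X \<subseteq> B" "chain_det k \<in> B"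
    interpret B: poly_ideal V B by fact
    have levX: "lev s C' < lev s (cx, cy)" if "C' \<in> X" for C'
      using that by (simp add: X C)
    show "p * h \<in> B"
    proof (rule inner_binomials_insert_cases[OF p[unfolded C] levX ab])
      assume "p \<in> inner_binomials X"
      then have "p \<in> B" using inner_binomials_subset_ideal[OF XV] B by auto
      then show ?thesis using B.mult_mem[OF h, of p] by (simp add: mult.commute)
    next
      fix ux uy
      assume 2: "p = minor ux bx uy by"
        "{min ux ax..<max ux ax} \<times> {min uy by..<max uy by} \<subseteq> X"
        "{min ax bx..<max ax bx} \<times> {min uy ay..<max uy ay} \<subseteq> X"
        "(ux, uy) \<in> vertices (insert (cx, cy) X)" "(ux, by) \<in> vertices (insert (cx, cy) X)"
      have uV: "(ux, uy) \<in> V" "(ux, by) \<in> V" using 2(4,5) CXV by (auto simp: C)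
      have m: "minor ux ax uy by \<in> B" "minor ax bx uy ay \<in> B"
        using 2(2,3) by (auto intro!: subsetD[OF B(1)] minor_mem_polyomino_ideal[OF XV])
      have "(\<Prod>j\<in>{1..<len k}. indet (px k j, py k j)) * chain_det k - gen k i * rest \<in> B"
        using B.poly_ideal_axioms B(1) by (rule factor)
      then have "gen k i * rest \<in> B"
        using B.diff_mem_iff B.mult_mem[OF diagV B(2)] by blast
      then have "- indet (ux, uy) * (gen k i * rest) \<in> B"
        using uV by (intro B.mult_mem[of "- indet (ux, uy)"]) (auto intro: carrier_uminus)
      moreover have "(rest * indet (bx, ay)) * minor ux ax uy by \<in> B"
        "(rest * indet (ux, by)) * minor ax bx uy ay \<in> B"
        using m uV CV rest
        by (auto intro!: B.mult_mem[of "rest * indet (bx, ay)"] B.mult_mem[of "rest * indet (ux, by)"] carrier_mult)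
      \<comment> \<open>\<open>minor_exchange\<close> multiplied by \<open>rest\<close>; the sign
        comes from \<open>gen_i\<close>.\<close>
      moreover have "p * h = - indet (ux, uy) * (gen k i * rest) + (rest * indet (bx, ay)) * minor ux ax uy by +
          (rest * indet (ux, by)) * minor ax bx uy ay"
      proof -
        have "p * h = rest * (indet (ax, ay) * minor ux bx uy by)"
          unfolding 2(1) h_def by (simp only: mult_ac)
        also have "\<dots> = rest * (indet (ux, uy) * minor ax bx ay by +
            indet (bx, ay) * minor ux ax uy by + indet (ux, by) * minor ax bx uy ay)"
          by (rule arg_cong[OF minor_exchange])
        finally show ?thesis unfolding gen_i by (simp only: distrib_left mult_minus_left mult_minus_right minus_minus mult_ac)
      qed
      ultimately show ?thesis by (simp only: B.add_mem)
    qed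
  qed
  then show ?thesis by (simp add: knutson_class0_def)
qed

text \<open>Induction on the number of cells, splitting off a cell of maximal level together with
  all cells of smaller level. Keeping just one cell on the top level is what leaves the binomials of
  the other cells of its chain outside the ideal, so that they can be cancelled.\<close>

lemma side_in_class:
  fixes f :: "(point, 'k::field) mpoly"
  assumes R: "loc_closed s R" "R \<subseteq> P" "finite R"
    and cover: "\<And>C. C \<in> R \<Longrightarrow> \<exists>k<length Vs. C \<in> chain_cells P (Vs ! k) \<and> chain_cells P (Vs ! k) \<subseteq> R"
    and det: "\<And>k. k < length Vs \<Longrightarrow> Idl\<^bsub>poly_ring V\<^esub> {chain_det k} \<in> knutson_class (poly_ring V) f"
  shows "X \<subseteq> R \<Longrightarrow> (\<And>C C'. C \<in> X \<Longrightarrow> C' \<in> R \<Longrightarrow> lev s C' < lev s C \<Longrightarrow> C' \<in> X) \<Longrightarrow>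
    polyomino_ideal (poly_ring V) X \<in> knutson_class0 V f"
proof (induction "card X" arbitrary: X rule: less_induct)
  case less
  let ?S = "poly_ring V :: (point, 'k) mpoly ring"
  interpret S: cring ?S by (rule cring_poly_ring)
  have fin: "finite X" using less.prems R(3) finite_subset by blast
  have XV: "vertices X \<subseteq> V" using less.prems R(2) by (intro vertices_mono) auto
  show ?case
  proof (cases "X = {}")
    case True
    have "polyomino_ideal ?S X = {0}"
    proof
      have "inner_binomials X = ({} :: (point, 'k) mpoly set)" by (auto simp: True inner_binomials_eq)
      then show "polyomino_ideal ?S X \<subseteq> {0}"
        using S.zeroideal by (intro polyomino_ideal_minimal) auto
      show "{0} \<subseteq> polyomino_ideal ?S X"
        using poly_ideal.zero_mem[OF poly_ideal_polyomino_ideal[OF XV]] by simp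
    qed
    then show ?thesis by (simp add: knutson_class0_def)
  next
    case False
    have "Max (lev s ` X) \<in> lev s ` X" using fin False by (intro Max_in) auto
    then obtain C where C: "C \<in> X" "lev s C = Max (lev s ` X)" by (metis imageE)
    have max: "lev s C' \<le> lev s C" if "C' \<in> X" for C'
      unfolding C(2) using fin that by (intro Max_ge) auto
    define Y where "Y = {C' \<in> R. lev s C' < lev s C}"
    have YX: "Y \<subseteq> X - {C}"
      using less.prems(2)[OF C(1)] unfolding Y_def by blast
    have card: "card (X - {C}) < card X" using C fin by (meson card_Diff1_less)
    have "card Y \<le> card (X - {C})" using YX fin by (intro card_mono) auto
    then have Y: "polyomino_ideal ?S Y \<in> knutson_class0 V f"
      using card by (intro less.hyps) (auto simp: Y_def)
    have XC: "polyomino_ideal ?S (X - {C}) \<in> knutson_class0 V f"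
      using card
    proof (rule less.hyps)
      fix D D' assume D: "D \<in> X - {C}" "D' \<in> R" "lev s D' < lev s D"
      then have "D' \<in> X" using less.prems by blast
      moreover have "D' \<noteq> C" using D max[of D] by auto
      ultimately show "D' \<in> X - {C}" by simp
    qed (use less.prems in auto)
    obtain k where k: "k < length Vs" "C \<in> chain_cells P (Vs ! k)" "chain_cells P (Vs ! k) \<subseteq> R"
      using cover C less.prems by blast
    have CY: "polyomino_ideal ?S (insert C Y) \<in> knutson_class0 V f"
      using add_cell_in_class[OF R(1,2) k Y_def det[OF k(1)] Y] .
    have sub: "vertices (X - {C}) \<subseteq> V" "vertices (insert C Y) \<subseteq> V"
      using XV vertices_mono[of "X - {C}" X] vertices_mono[of "insert C Y" X] C YX by auto
    interpret A: poly_ideal V "polyomino_ideal ?S (X - {C})" using sub(1) by (rule poly_ideal_polyomino_ideal)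
    interpret B: poly_ideal V "polyomino_ideal ?S (insert C Y)" using sub(2) by (rule poly_ideal_polyomino_ideal)
    interpret J: poly_ideal V "polyomino_ideal ?S X" using XV by (rule poly_ideal_polyomino_ideal)
    have "polyomino_ideal ?S X = polyomino_ideal ?S (X - {C}) <+>\<^bsub>?S\<^esub> polyomino_ideal ?S (insert C Y)"
    proof
      show "polyomino_ideal ?S X \<subseteq> polyomino_ideal ?S (X - {C}) <+>\<^bsub>?S\<^esub> polyomino_ideal ?S (insert C Y)"
      proof (rule polyomino_ideal_minimal)
        show "ideal (polyomino_ideal ?S (X - {C}) <+>\<^bsub>?S\<^esub> polyomino_ideal ?S (insert C Y)) ?S"
          by (intro S.add_ideals A.is_ideal B.is_ideal)
        show "inner_binomials X \<subseteq> polyomino_ideal ?S (X - {C}) <+>\<^bsub>?S\<^esub> polyomino_ideal ?S (insert C Y)"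
        proof
          fix p :: "(point, 'k) mpoly" assume "p \<in> inner_binomials X"
          then obtain x1 x2 y1 y2 where p: "p = minor x1 x2 y1 y2" "x1 < x2" "y1 < y2"
            and r: "{x1..<x2} \<times> {y1..<y2} \<subseteq> X"
            unfolding inner_binomials_eq by blast
          \<comment> \<open>By maximality of its level, \<open>C\<close> can only be the extreme
            corner cell of an interval; all other cells of that interval then have smaller level and
            lie in \<open>Y\<close>.\<close>
          have "{x1..<x2} \<times> {y1..<y2} \<subseteq> X - {C} \<or> {x1..<x2} \<times> {y1..<y2} \<subseteq> insert C Y"
          proof (cases "C \<in> {x1..<x2} \<times> {y1..<y2}")
            case True
            then obtain cx cy where cxy: "C = (cx, cy)" "x1 \<le> cx" "cx < x2" "y1 \<le> cy" "cy < y2" by auto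
            have inX: "(x, y) \<in> X" if "x1 \<le> x" "x < x2" "y1 \<le> y" "y < y2" for x y
              using r that by auto
            have cov: "(x, y) \<in> insert C Y" if xy: "x1 \<le> x" "x < x2" "y1 \<le> y" "y < y2" for x y
            proof (cases "s")
              case True
              have "Suc cx = x2" "Suc cy = y2"
                using max[of "(Suc cx, cy)"] max[of "(cx, Suc cy)"] inX[of "Suc cx" cy] inX[of cx "Suc cy"] cxy True
                by (fastforce simp: lev_def)+
              then have "x \<le> cx" "y \<le> cy" using xy by auto
              then show ?thesis
                using inX[OF xy] less.prems True cxy by (auto simp: Y_def lev_def)
            next
              case False
              have "cx = x1" "cy = y1"
                using max[of "(cx - 1, cy)"] max[of "(cx, cy - 1)"] inX[of "cx - 1" cy] inX[of cx "cy - 1"] cxy False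
                by (fastforce simp: lev_def)+
              then have "cx \<le> x" "cy \<le> y" using xy by auto
              then show ?thesis
                using inX[OF xy] less.prems False cxy by (auto simp: Y_def lev_def)
            qed
            have "z \<in> insert C Y" if "z \<in> {x1..<x2} \<times> {y1..<y2}" for z
              using that cov[of "fst z" "snd z"] by (auto simp: mem_Times_iff)
            then show ?thesis by blast
          qed (use r in blast)
          then have "p \<in> inner_binomials (X - {C}) \<or> p \<in> inner_binomials (insert C Y)"
            unfolding inner_binomials_eq using p by blast
          then have "p \<in> polyomino_ideal ?S (X - {C}) \<or> p \<in> polyomino_ideal ?S (insert C Y)"
            using inner_binomials_subset_ideal[OF sub(1)] inner_binomials_subset_ideal[OF sub(2)] by blast
          moreover have "p = p + 0" "p = 0 + p" by simp_all
          ultimately show "p \<in> polyomino_ideal ?S (X - {C}) <+>\<^bsub>?S\<^esub> polyomino_ideal ?S (insert C Y)"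
            unfolding set_add_poly_ring using A.zero_mem B.zero_mem by blast
        qed
      qed
      have "polyomino_ideal ?S (X - {C}) \<subseteq> polyomino_ideal ?S X" "polyomino_ideal ?S (insert C Y) \<subseteq> polyomino_ideal ?S X"
        using C YX by (intro polyomino_ideal_mono[OF _ XV]; blast)+
      then show "polyomino_ideal ?S (X - {C}) <+>\<^bsub>?S\<^esub> polyomino_ideal ?S (insert C Y) \<subseteq> polyomino_ideal ?S X"
        unfolding set_add_poly_ring using J.add_mem by blast
    qed
    then show ?thesis using knutson_class0_add[OF XC CY] by simp
  qed
qed

section \<open>The polynomial defining the Knutson class\<close>

definition chain_product :: "(point, 'k::field) mpoly" where
  "chain_product = (\<Prod>k<length Vs. chain_det k)"

lemma chain_det_in_class:
  assumes "k < length Vs"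
  shows "Idl\<^bsub>poly_ring V\<^esub> {chain_det k :: (point, 'k::field) mpoly} \<in> knutson_class (poly_ring V) chain_product"
proof -
  let ?g = "\<Prod>l\<in>{..<length Vs} - {k}. chain_det l :: (point, 'k) mpoly"
  have "leads (\<Sum>l\<in>{..<length Vs} - {k}. \<Sum>i<len l. single (px l i, py l i) 1) ?g"
    by (intro leads_prod leads_chain_det) auto
  then have "?g \<noteq> 0" by (rule leads_nonzero)
  moreover have "chain_product = chain_det k * ?g"
    using assms by (simp add: chain_product_def prod.remove[of _ k])
  ultimately show ?thesis
    using Idl_factor_in_knutson_class[OF chain_det_carrier carrier_prod[OF chain_det_carrier]] by simp
qed

text \<open>The chains partition \<open>V\<close>, so each vertex occurs on exactly one diagonal and
  with exponent 1.\<close>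

lemma leads_chain_product: "leads (\<Sum>v\<in>V. single v 1) (chain_product :: (point, 'k::field) mpoly)"
proof -
  have "(\<Sum>v\<in>V. single v 1 :: point monom) = (\<Sum>v\<in>(\<Union>k<length Vs. set (Vs ! k)). single v 1)"
    unfolding union_chains[symmetric] set_conv_nth[of Vs] by (rule sum.cong) auto
  also have "\<dots> = (\<Sum>k<length Vs. \<Sum>v\<in>set (Vs ! k). single v 1)"
  proof (rule sum.UNION_disjoint)
    show "\<forall>k\<in>{..<length Vs}. \<forall>l\<in>{..<length Vs}. k \<noteq> l \<longrightarrow> set (Vs ! k) \<inter> set (Vs ! l) = {}"
      using chain_unique by blast
  qed simp_all
  also have "\<dots> = (\<Sum>k<length Vs. \<Sum>i<len k. single (px k i, py k i) 1)"
  proof (rule sum.cong)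
    fix k assume "k \<in> {..<length Vs}"
    then have k: "k < length Vs" by simp
    have "inj_on (\<lambda>i. (px k i, py k i)) {..<len k}"
      by (rule inj_onI) (use px_eq[OF k] in auto)
    moreover have "set (Vs ! k) = (\<lambda>i. (px k i, py k i)) ` {..<len k}"
      by (auto simp: mem_chain_iff)
    ultimately show "(\<Sum>v\<in>set (Vs ! k). single v 1 :: point monom) = (\<Sum>i<len k. single (px k i, py k i) 1)"
      by (simp add: sum.reindex)
  qed simp
  finally have eq: "(\<Sum>v\<in>V. single v 1 :: point monom) = (\<Sum>k<length Vs. \<Sum>i<len k. single (px k i, py k i) 1)" .
  show ?thesis
    unfolding chain_product_def eq by (intro leads_prod leads_chain_det) simp
qed

end

text \<open>Rules out the extra member \<open>{0}\<close> of \<open>knutson_class0\<close> at the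
  end. A single cell already gives a nonzero binomial, as its two terms are distinct
  monomials.\<close>

lemma polyomino_ideal_nonzero:
  assumes "C \<in> P" "vertices P \<subseteq> V"
  shows "polyomino_ideal (poly_ring V) P \<noteq> ({0} :: (point, 'k::field) mpoly set)"
proof
  obtain x y where C: "C = (x, y)" by fastforce
  let ?m = "single (x, y) 1 + single (Suc x, Suc y) 1 :: point monom"
  let ?n = "single (x, Suc y) 1 + single (Suc x, y) 1 :: point monom"
  assume "polyomino_ideal (poly_ring V) P = ({0} :: (point, 'k) mpoly set)"
  moreover have "(minor x (Suc x) y (Suc y) :: (point, 'k) mpoly) \<in> polyomino_ideal (poly_ring V) P"
    using assms C by (intro minor_mem_polyomino_ideal) auto
  ultimately have "(mon ?m :: (point, 'k) mpoly) = mon ?n"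
    by (simp add: minor_def indet_def mult_single)
  then have "keys (mon ?m :: (point, 'k) mpoly) = keys (mon ?n :: (point, 'k) mpoly)" by simp
  then have "?m = ?n" by simp
  then have "lookup ?m (x, y) = lookup ?n (x, y)" by simp
  then show False by (simp add: lookup_add lookup_single)
qed

theorem theorem6p2:
  fixes Q Q' P Q\<^sub>1 Q\<^sub>2 :: "cell set"
    and Vs :: "point list list"
    and a b :: nat
    and S :: "(point, 'k::field) mpoly ring"
  assumes "parallelogram_polyomino Q"
    and "sub_polyomino Q' Q"
    and "parallelogram_polyomino Q'"
    and "P = Q - Q'"
    and "P \<noteq> {}"
    and "S = poly_ring (vertices P)"
    and "antidiagonal_partition P Vs"
    and "a = Min {i. i < length Vs \<and> set (Vs ! i) \<inter> vertices Q' \<noteq> {}}"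
    and "b = Max {i. i < length Vs \<and> set (Vs ! i) \<inter> vertices Q' \<noteq> {}}"
    and "Q\<^sub>1 = (\<Union>i\<in>{i. i < length Vs \<and> i < b}. chain_cells P (Vs ! i))"
    and "Q\<^sub>2 = (\<Union>i\<in>{i. i < length Vs \<and> a < i}. chain_cells P (Vs ! i))"
    and "polyomino_ideal S Q\<^sub>1 <+>\<^bsub>S\<^esub> polyomino_ideal S Q\<^sub>2 = polyomino_ideal S P"
  shows "knutson_ideal (vertices P) (polyomino_ideal S P)"
proof -
  interpret chains P Vs by unfold_locales (rule assms(7))
  let ?f = "chain_product :: (point, 'k) mpoly"
  have "finite Q" using assms(1) by (simp add: parallelogram_polyomino_def polyomino_def)
  then have "finite P" using assms(4) by simp
  have sub: "chain_cells P (Vs ! k) \<subseteq> P" for k by (auto simp: chain_cells_def)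
  have Q1: "polyomino_ideal S Q\<^sub>1 \<in> knutson_class0 V ?f" unfolding assms(6)
  proof (rule side_in_class)
    show "loc_closed True Q\<^sub>1"
      unfolding assms(10) using loc_closed_lower assms(1,3,4,7,9) .
    show "Q\<^sub>1 \<subseteq> P" unfolding assms(10) using sub by blast
    then show "finite Q\<^sub>1" using \<open>finite P\<close> finite_subset by blast
    show "\<exists>k<length Vs. C \<in> chain_cells P (Vs ! k) \<and> chain_cells P (Vs ! k) \<subseteq> Q\<^sub>1" if "C \<in> Q\<^sub>1" for C
      using that unfolding assms(10) by blast
  qed (auto intro: chain_det_in_class)
  have Q2: "polyomino_ideal S Q\<^sub>2 \<in> knutson_class0 V ?f" unfolding assms(6)
  proof (rule side_in_class)
    show "loc_closed False Q\<^sub>2"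
      unfolding assms(11) using loc_closed_upper assms(1,3,4,7,8) .
    show "Q\<^sub>2 \<subseteq> P" unfolding assms(11) using sub by blast
    then show "finite Q\<^sub>2" using \<open>finite P\<close> finite_subset by blast
    show "\<exists>k<length Vs. C \<in> chain_cells P (Vs ! k) \<and> chain_cells P (Vs ! k) \<subseteq> Q\<^sub>2" if "C \<in> Q\<^sub>2" for C
      using that unfolding assms(11) by blast
  qed (auto intro: chain_det_in_class)
  have "polyomino_ideal S P \<in> knutson_class0 V ?f"
    using knutson_class0_add[OF Q1 Q2] assms(6,12) by simp
  moreover have "polyomino_ideal S P \<noteq> {0}"
    using assms(5) polyomino_ideal_nonzero[of _ P V] unfolding assms(6) by blast
  ultimately have "polyomino_ideal S P \<in> knutson_class (poly_ring V) ?f"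
    by (simp add: knutson_class0_def)
  moreover have f: "?f \<in> carrier (poly_ring V)"
    unfolding chain_product_def by (intro carrier_prod chain_det_carrier)
  moreover have "initial_monom (weight_order V) ?f = (\<Sum>v\<in>V. single v 1)"
    using leads_chain_product f by (rule initial_monom_eq)
  \<comment> \<open>Over an infinite index set the sum is 0 by convention, the exponent vector of 1,
    so both cases of the split are square-free.\<close>
  then have "squarefree_monom (initial_monom (weight_order V) ?f)"
    unfolding squarefree_monom_def
    by (cases "finite V") (auto simp: lookup_sum lookup_single when_def)
  ultimately show ?thesis
    unfolding knutson_ideal_def
    using monomial_order_weight_order leads_nonzero[OF leads_chain_product] by blast
qed

end
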